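(* Let $n\ge2$, $\gamma>1$, $L>0$ and $\phi=\frac{2}{1+\gamma}$. There is a sufficiently small constant $K_0=K_0(n,\gamma,L)>0$ such that the following holds for every $0<K\le K_0$. Let $\Gamma=\{x_n=g(x')\}$ with $\|g\|_{C^{0,1}(B_{20}')}\le L$ and $$-\frac1K+\sqrt{\frac1{K^2}-|x'|^2}\le g(x')\le\frac1K-\sqrt{\frac1{K^2}-|x'|^2}\qquad\text{in }B_{20}'.$$ Suppose that $u$ is a solution of $-\Delta u=u^{-\gamma}$ in $\mathcal{GC}_{20}(0)$ and that $u$ vanishes on $\Gamma$. Denote $\lambda=u(\vec e_n)$. Then $\lambda\gtrsim1$, and for $t\in[0,1]$ $$u(t\vec e_n)\sim\begin{cases}t^{\phi},&\text{if }t\le\lambda^{\frac{1+\gamma}{1-\gamma}},\\ \lambda t,&\text{if }t\ge\lambda^{\frac{1+\gamma}{1-\gamma}}.\end{cases}$$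
   Context: Points of $\mathbb{R}^n$ are written $x=(x',x_n)$; $B_r'$ is the ball of radius $r$ centered at $0$ in $\mathbb{R}^{n-1}$; $\vec e_n$ is the $n$-th unit vector. The grounded cylinder at the origin (note $g(0)=0$) is $$\mathcal{GC}_r(0)=\{y=(y',y_n):|y'|\le r,\ 0\le y_n-g(y')\le r\}.$$ A solution is positive in $\{y_n>g(y')\}$, satisfies the equation classically in the interior of the cylinder, and is continuous up to $\Gamma$, where it equals $0$. $q_1\lesssim q_2$ means $q_1\le Cq_2$ for a constant $C>0$ depending only on $(n,\gamma,L,K)$ (in particular independent of $u$, $\lambda$, $t$); $q_1\gtrsim q_2$ means $q_2\lesssim q_1$; $q_1\sim q_2$ means both. *)

theory Defs
  imports "HOL-Analysis.Analysis"
begin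

text \<open>
  Points of the ambient space are pairs \<open>y = (y', y\<^sub>n)\<close> in \<open>'a \<times> real\<close>; the product norm is the
  Euclidean one. Taking \<open>'a = real ^ 'm\<close> gives \<open>n = CARD('m) + 1\<close>, hence exactly the
  dimensions \<open>n \<ge> 2\<close>.
\<close>

definition e_n :: "'a::euclidean_space \<times> real" where
  "e_n = (0, 1)"

definition C1_on :: "'a::euclidean_space set \<Rightarrow> ('a \<Rightarrow> real) \<Rightarrow> bool" where
  "C1_on S f \<longleftrightarrow>
     (\<forall>x\<in>S. f differentiable (at x)) \<and>
     (\<forall>h. continuous_on S (\<lambda>x. frechet_derivative f (at x) h))"

definition C2_on :: "'a::euclidean_space set \<Rightarrow> ('a \<Rightarrow> real) \<Rightarrow> bool" where
  "C2_on S f \<longleftrightarrow>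
     C1_on S f \<and> (\<forall>h. C1_on S (\<lambda>x. frechet_derivative f (at x) h))"

definition laplacian :: "('a::euclidean_space \<Rightarrow> real) \<Rightarrow> 'a \<Rightarrow> real" where
  "laplacian f x =
     (\<Sum>b\<in>Basis. frechet_derivative (\<lambda>y. frechet_derivative f (at y) b) (at x) b)"

text \<open>
  The full \<open>C\<^sup>0\<^sup>,\<^sup>1\<close> norm, supremum norm plus Lipschitz seminorm, with value \<open>\<infinity>\<close> outside the space.
\<close>

definition C01_norm :: "'a::metric_space set \<Rightarrow> ('a \<Rightarrow> real) \<Rightarrow> ennreal" where
  "C01_norm S g =
     (SUP x\<in>S. ennreal \<bar>g x\<bar>) +
     (SUP x\<in>S. SUP y\<in>S - {x}. ennreal (\<bar>g x - g y\<bar> / dist x y))"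

definition grounded_cylinder ::
    "('a::euclidean_space \<Rightarrow> real) \<Rightarrow> real \<Rightarrow> ('a \<times> real) set" where
  "grounded_cylinder g r =
     {y. norm (fst y) \<le> r \<and> 0 \<le> snd y - g (fst y) \<and> snd y - g (fst y) \<le> r}"

definition graph_over ::
    "'a::euclidean_space set \<Rightarrow> ('a \<Rightarrow> real) \<Rightarrow> ('a \<times> real) set" where
  "graph_over S g = {y. fst y \<in> S \<and> snd y = g (fst y)}"

text \<open>
  Solutions of \<open>-\<Delta>u = u\<^sup>-\<^sup>\<gamma>\<close> in the grounded cylinder of radius \<open>r\<close> that vanish on the surface
  \<open>\<Gamma>\<close>, the graph of \<open>g\<close> over the open ball. Continuity is required up to \<open>\<Gamma>\<close> only, not up to the
  lateral and top parts of the boundary of the cylinder.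
\<close>

definition is_solution ::
    "real \<Rightarrow> ('a::euclidean_space \<Rightarrow> real) \<Rightarrow> real \<Rightarrow> ('a \<times> real \<Rightarrow> real) \<Rightarrow> bool" where
  "is_solution \<gamma> g r u \<longleftrightarrow>
     (\<forall>y\<in>grounded_cylinder g r. g (fst y) < snd y \<longrightarrow> 0 < u y) \<and>
     C2_on (interior (grounded_cylinder g r)) u \<and>
     (\<forall>y\<in>interior (grounded_cylinder g r). - laplacian u y = u y powr (- \<gamma>)) \<and>
     continuous_on (interior (grounded_cylinder g r) \<union> graph_over (ball 0 r) g) u \<and>
     (\<forall>y\<in>graph_over (ball 0 r) g. u y = 0)"

definition comparable :: "real \<Rightarrow> real \<Rightarrow> real \<Rightarrow> bool" where
  "comparable C q1 q2 \<longleftrightarrow> q1 \<le> C * q2 \<and> q2 \<le> C * q1"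

end

theory Submission
  imports Defs
begin

text \<open>
  The function \<open>max (t\<^sup>\<phi>) (\<lambda> t)\<close> is the size of \<open>u (t e\<^sub>n)\<close>. From below, \<open>t\<^sup>\<phi>\<close> comes from comparison with
  a paraboloid in a ball contained in the domain, and \<open>\<lambda> t\<close> from the Hopf barrier in the interior
  tangent ball. From above, the exterior tangent ball carries a supersolution \<open>A s\<^sup>\<phi> + B s\<close>, whose
  constant \<open>B\<close> is of size \<open>\<lambda>\<close> as soon as \<open>u \<lesssim> \<lambda>\<close> near the origin. This Carleson estimate combines
  a Harnack inequality, obtained from averages against a radial kernel, with the decay of \<open>u\<close> at the
  Lipschitz graph.
\<close>

section \<open>Radial barriers\<close>

lemma second_derivative_local_max:
  fixes q q' :: "real \<Rightarrow> real"
  assumes "d > 0"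
    and q: "\<And>s. \<bar>s\<bar> < d \<Longrightarrow> (q has_real_derivative q' s) (at s)"
    and q': "(q' has_real_derivative c) (at 0)"
    and max: "\<And>s. \<bar>s\<bar> < d \<Longrightarrow> q s \<le> q 0"
  shows "c \<le> 0"
proof (rule ccontr)
  assume "\<not> c \<le> 0"
  hence "c > 0" by simp
  have q0: "(q has_real_derivative q' 0) (at 0)" using q[of 0] \<open>d > 0\<close> by simp
  have "\<forall>y. \<bar>0 - y\<bar> < d \<longrightarrow> q y \<le> q 0" using max by simp
  then have z: "q' 0 = 0" by (rule DERIV_local_max[OF q0 \<open>d > 0\<close>])
  from DERIV_pos_inc_right[OF q' \<open>c > 0\<close>]
  obtain e where e: "e > 0" "\<forall>h>0. h < e \<longrightarrow> q' 0 < q' (0 + h)" by blast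
  define s where "s = min d e / 2"
  have s: "0 < s" "s < d" "s < e" using \<open>d > 0\<close> \<open>e > 0\<close> unfolding s_def by linarith+
  have "q 0 < q s"
  proof (rule DERIV_pos_imp_increasing_open[OF s(1)])
    fix x assume "0 < x" "x < s"
    then show "\<exists>y. (q has_real_derivative y) (at x) \<and> 0 < y"
      using q[of x] e(2)[rule_format, of x] s(2,3) z by (intro exI[of _ "q' x"] conjI) simp_all
  next
    show "continuous_on {0..s} q"
    proof (rule DERIV_continuous_on)
      fix x assume "x \<in> {0..s}"
      then show "(q has_real_derivative q' x) (at x within {0..s})"
        using q[of x] s(1,2) by (simp add: has_field_derivative_at_within)
    qed
  qed
  moreover have "q s \<le> q 0" using max[of s] s(1,2) by simp
  ultimately show False by simp
qed

lemma has_real_derivative_along_line: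
  fixes f :: "'a::euclidean_space \<Rightarrow> real"
  assumes "f differentiable (at (x + s *\<^sub>R b))"
  shows "((\<lambda>s. f (x + s *\<^sub>R b)) has_real_derivative
           frechet_derivative f (at (x + s *\<^sub>R b)) b) (at s)"
proof -
  let ?D = "frechet_derivative f (at (x + s *\<^sub>R b))"
  have D: "(f has_derivative ?D) (at (x + s *\<^sub>R b))"
    using assms by (simp add: frechet_derivative_works)
  have "((\<lambda>s. f (x + s *\<^sub>R b)) has_derivative (\<lambda>h. ?D (h *\<^sub>R b))) (at s)"
  proof (rule has_derivative_compose[of "\<lambda>s. x + s *\<^sub>R b" "\<lambda>h. h *\<^sub>R b", OF _ D])
    show "((\<lambda>s. x + s *\<^sub>R b) has_derivative (\<lambda>h. h *\<^sub>R b)) (at s)"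
      by (auto intro!: derivative_eq_intros)
  qed
  moreover have "?D (h *\<^sub>R b) = ?D b * h" for h
    using linear_scale[OF has_derivative_linear[OF D]] by simp
  ultimately show ?thesis
    by (simp add: has_field_derivative_def)
qed

lemma C2_on_differentiable:
  assumes "C2_on U f" "x \<in> U"
  shows "f differentiable (at x)" "(\<lambda>y. frechet_derivative f (at y) h) differentiable (at x)"
  using assms by (auto simp: C2_on_def C1_on_def)

lemma C2_on_continuous:
  assumes "C2_on U f"
  shows "continuous_on U f" "continuous_on U (\<lambda>y. frechet_derivative f (at y) h)"
    "continuous_on U (\<lambda>x. frechet_derivative (\<lambda>y. frechet_derivative f (at y) h) (at x) k)"
proof -
  note D = C2_on_differentiable[OF assms]
  show "continuous_on U f" "continuous_on U (\<lambda>y. frechet_derivative f (at y) h)"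
    using D by (blast intro: continuous_at_imp_continuous_on differentiable_imp_continuous_within)+
  show "continuous_on U (\<lambda>x. frechet_derivative (\<lambda>y. frechet_derivative f (at y) h) (at x) k)"
    using assms by (simp add: C2_on_def C1_on_def)
qed

lemma C2_on_laplacian_continuous:
  assumes "C2_on U f"
  shows "continuous_on U (laplacian f)"
  unfolding laplacian_def[abs_def] by (intro continuous_on_sum C2_on_continuous(3)[OF assms])

lemma C2_on_subset: "C2_on U f \<Longrightarrow> V \<subseteq> U \<Longrightarrow> C2_on V f"
  unfolding C2_on_def C1_on_def by (blast intro: continuous_on_subset)

lemma sum_inner_Basis_power2:
  fixes x :: "'a::euclidean_space"
  shows "(\<Sum>b\<in>Basis. (x \<bullet> b)\<^sup>2) = (norm x)\<^sup>2"
proof -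
  have "(norm x)\<^sup>2 = x \<bullet> x" by (rule power2_norm_eq_inner)
  also have "\<dots> = (\<Sum>b\<in>Basis. (x \<bullet> b)\<^sup>2)"
    by (subst euclidean_inner) (simp only: power2_eq_square)
  finally show ?thesis by simp
qed

lemma laplacian_radial_touching:
  fixes u :: "'a::euclidean_space \<Rightarrow> real" and F F1 :: "real \<Rightarrow> real" and \<sigma> :: real
  assumes U: "open U" "C2_on U u" "x0 \<in> U"
    and T: "open T" "(norm (x0 - p))\<^sup>2 \<in> T"
    and F: "\<And>a. a \<in> T \<Longrightarrow> (F has_real_derivative F1 a) (at a)"
    and F1: "(F1 has_real_derivative F2) (at ((norm (x0 - p))\<^sup>2))"
    and d: "d > 0"
    and max: "\<And>x. x \<in> ball x0 d \<Longrightarrow>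
      \<sigma> * (u x - F ((norm (x - p))\<^sup>2)) \<le> \<sigma> * (u x0 - F ((norm (x0 - p))\<^sup>2))"
  shows "\<sigma> * laplacian u x0 \<le>
    \<sigma> * (4 * (norm (x0 - p))\<^sup>2 * F2 + 2 * DIM('a) * F1 ((norm (x0 - p))\<^sup>2))"
proof -
  define \<alpha> where "\<alpha> = (norm (x0 - p))\<^sup>2"
  define D2 where "D2 b = frechet_derivative (\<lambda>y. frechet_derivative u (at y) b) (at x0) b" for b
  have le: "\<sigma> * (D2 b - (4 * F2 * ((x0 - p) \<bullet> b)\<^sup>2 + 2 * F1 \<alpha>)) \<le> 0" if b: "b \<in> Basis" for b
  proof -
    define \<beta> where "\<beta> = (x0 - p) \<bullet> b"
    define m where "m s = \<alpha> + 2 * \<beta> * s + s\<^sup>2" for s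
    have m: "(norm (x0 + s *\<^sub>R b - p))\<^sup>2 = m s" for s
    proof -
      have "x0 + s *\<^sub>R b - p = (x0 - p) + s *\<^sub>R b" by simp
      then show ?thesis
        using b by (simp only: power2_norm_eq_inner m_def \<alpha>_def \<beta>_def)
          (simp add: inner_add_left inner_add_right inner_Basis inner_commute power2_eq_square algebra_simps)
    qed
    have "open ((\<lambda>s. x0 + s *\<^sub>R b) -` (U \<inter> ball x0 d) \<inter> m -` T)"
      unfolding m_def using U(1) T(1)
      by (intro open_Int open_vimage continuous_intros) auto
    moreover have "0 \<in> (\<lambda>s. x0 + s *\<^sub>R b) -` (U \<inter> ball x0 d) \<inter> m -` T"
      using U(3) T(2) d by (auto simp: m_def \<alpha>_def)
    ultimately obtain e where e: "e > 0"
      "ball 0 e \<subseteq> (\<lambda>s. x0 + s *\<^sub>R b) -` (U \<inter> ball x0 d) \<inter> m -` T"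
      using open_contains_ball by metis
    have e': "x0 + s *\<^sub>R b \<in> U" "x0 + s *\<^sub>R b \<in> ball x0 d" "m s \<in> T" if "\<bar>s\<bar> < e" for s
      using e(2) that by (auto simp: subset_iff)
    define q where "q s = \<sigma> * (u (x0 + s *\<^sub>R b) - F (m s))" for s
    define q' where "q' s = \<sigma> * (frechet_derivative u (at (x0 + s *\<^sub>R b)) b - F1 (m s) * (2 * \<beta> + 2 * s))" for s
    have m': "(m has_real_derivative (2 * \<beta> + 2 * s)) (at s)" for s
      unfolding m_def by (auto intro!: derivative_eq_intros)
    have "\<sigma> * (D2 b - (F2 * (2 * \<beta> + 2 * 0) * (2 * \<beta> + 2 * 0) + F1 (m 0) * 2)) \<le> 0"
    proof (rule second_derivative_local_max[OF e(1), of q q'])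
      fix s assume s: "\<bar>s\<bar> < e"
      show "(q has_real_derivative q' s) (at s)"
        unfolding q_def q'_def
        by (rule DERIV_cmult[OF DERIV_diff[OF has_real_derivative_along_line[OF
            C2_on_differentiable(1)[OF U(2) e'(1)[OF s]]] DERIV_chain2[OF F[OF e'(3)[OF s]] m']]])
      show "q s \<le> q 0"
        using max[OF e'(2)[OF s]] by (simp add: q_def m[symmetric])
    next
      have F1': "(F1 has_real_derivative F2) (at (m 0))"
        using F1 by (simp add: m_def \<alpha>_def)
      have "((\<lambda>s. F1 (m s) * (2 * \<beta> + 2 * s)) has_real_derivative
         F2 * (2 * \<beta> + 2 * 0) * (2 * \<beta> + 2 * 0) + F1 (m 0) * 2) (at 0)"
        by (rule DERIV_cong[OF DERIV_mult[OF DERIV_chain2[OF F1' m']]])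
           (auto intro!: derivative_eq_intros)
      moreover have "((\<lambda>s. frechet_derivative u (at (x0 + s *\<^sub>R b)) b) has_real_derivative D2 b) (at 0)"
        using has_real_derivative_along_line[OF C2_on_differentiable(2)[OF U(2), of "x0 + 0 *\<^sub>R b" b]] U(3)
        by (simp add: D2_def)
      ultimately show "(q' has_real_derivative
        \<sigma> * (D2 b - (F2 * (2 * \<beta> + 2 * 0) * (2 * \<beta> + 2 * 0) + F1 (m 0) * 2))) (at 0)"
        unfolding q'_def using DERIV_cmult[OF DERIV_diff] by blast
    qed
    then show ?thesis by (simp add: m_def \<beta>_def power2_eq_square mult_ac)
  qed
  have "(\<Sum>b\<in>Basis. \<sigma> * (D2 b - (4 * F2 * ((x0 - p) \<bullet> b)\<^sup>2 + 2 * F1 \<alpha>))) \<le> 0"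
    by (intro sum_nonpos le)
  also have "(\<Sum>b\<in>Basis. \<sigma> * (D2 b - (4 * F2 * ((x0 - p) \<bullet> b)\<^sup>2 + 2 * F1 \<alpha>))) =
    \<sigma> * (laplacian u x0 - (4 * F2 * \<alpha> + 2 * DIM('a) * F1 \<alpha>))"
    unfolding sum_distrib_left[symmetric] sum_subtractf sum.distrib
    by (simp add: sum_inner_Basis_power2 laplacian_def D2_def \<alpha>_def)
  finally show ?thesis by (simp add: \<alpha>_def algebra_simps)
qed

text \<open>Here \<open>\<sigma> = 1\<close> is for upper and \<open>\<sigma> = -1\<close> for lower barriers \<open>w (x) = F (|x - p|\<^sup>2)\<close>; then
  \<open>\<Delta>w = 4 \<alpha> F'' + 2 n F'\<close> at \<open>\<alpha> = |x - p|\<^sup>2\<close>.\<close>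

lemma radial_comparison:
  fixes u :: "'a::euclidean_space \<Rightarrow> real" and F F1 :: "real \<Rightarrow> real" and \<sigma> :: real
  assumes U: "open U" "C2_on U u" and D: "compact D"
    and cont: "continuous_on D u" "continuous_on D (\<lambda>x. F ((norm (x - p))\<^sup>2))"
    and T: "open T"
    and F: "\<And>a. a \<in> T \<Longrightarrow> (F has_real_derivative F1 a) (at a)"
    and F1: "\<And>a. a \<in> T \<Longrightarrow> (F1 has_real_derivative F2 a) (at a)"
    and viol: "\<And>x. x \<in> D \<Longrightarrow> \<sigma> * F ((norm (x - p))\<^sup>2) < \<sigma> * u x \<Longrightarrow>
       x \<in> U \<and> x \<in> interior D \<and> (norm (x - p))\<^sup>2 \<in> T \<and>
       \<sigma> * (4 * (norm (x - p))\<^sup>2 * F2 ((norm (x - p))\<^sup>2) + 2 * DIM('a) * F1 ((norm (x - p))\<^sup>2))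
         < \<sigma> * laplacian u x"
    and x: "x \<in> D"
  shows "\<sigma> * u x \<le> \<sigma> * F ((norm (x - p))\<^sup>2)"
proof -
  let ?w = "\<lambda>x. \<sigma> * (u x - F ((norm (x - p))\<^sup>2))"
  have "continuous_on D ?w" by (intro continuous_intros cont)
  then obtain x0 where x0: "x0 \<in> D" "\<And>y. y \<in> D \<Longrightarrow> ?w y \<le> ?w x0"
    using continuous_attains_sup[OF D _ \<open>continuous_on D ?w\<close>] x by auto
  have "\<not> \<sigma> * F ((norm (x0 - p))\<^sup>2) < \<sigma> * u x0"
  proof
    assume less: "\<sigma> * F ((norm (x0 - p))\<^sup>2) < \<sigma> * u x0"
    note v = viol[OF x0(1) less]
    then obtain d where d: "d > 0" "ball x0 d \<subseteq> D"
      by (meson mem_interior)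
    have "x0 \<in> U" "(norm (x0 - p))\<^sup>2 \<in> T" using v by auto
    have "\<sigma> * laplacian u x0 \<le>
      \<sigma> * (4 * (norm (x0 - p))\<^sup>2 * F2 ((norm (x0 - p))\<^sup>2) + 2 * DIM('a) * F1 ((norm (x0 - p))\<^sup>2))"
      by (rule laplacian_radial_touching[OF U _ T _ F F1 d(1)])
        (use d(2) \<open>x0 \<in> U\<close> \<open>(norm (x0 - p))\<^sup>2 \<in> T\<close> in \<open>auto intro!: x0(2)\<close>)
    with v show False by simp
  qed
  with x0(2)[OF x] show ?thesis by (simp add: right_diff_distrib)
qed

section \<open>The mean value inequality\<close>

lemma has_real_derivative_pos_part_cube:
  "((\<lambda>x::real. (max 0 x) ^ 3) has_real_derivative 3 * (max 0 x)\<^sup>2) (at x)"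
proof -
  consider "x < 0" | "x > 0" | "x = 0" by linarith
  then show ?thesis
  proof cases
    case 1
    have "((\<lambda>x::real. 0) has_real_derivative 3 * (max 0 x)\<^sup>2) (at x)"
      using 1 by (auto intro!: derivative_eq_intros)
    then show ?thesis
      by (rule has_field_derivative_transform_within_open[of _ _ _ "{..<0}"]) (use 1 in auto)
  next
    case 2
    have "((\<lambda>x::real. x ^ 3) has_real_derivative 3 * (max 0 x)\<^sup>2) (at x)"
      using 2 by (auto intro!: derivative_eq_intros)
    then show ?thesis
      by (rule has_field_derivative_transform_within_open[of _ _ _ "{0<..}"]) (use 2 in auto)
  next
    case 3
    have "((\<lambda>h::real. (max 0 h) ^ 3 / h) \<longlongrightarrow> 0) (at 0)"
    proof (rule Lim_null_comparison)
      show "\<forall>\<^sub>F h in at 0. norm ((max 0 h) ^ 3 / h) \<le> (h::real)\<^sup>2"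
        by (rule always_eventually) (auto simp: max_def power3_eq_cube power2_eq_square)
      show "((\<lambda>h::real. h\<^sup>2) \<longlongrightarrow> 0) (at 0)"
        by (auto intro!: tendsto_eq_intros)
    qed
    then show ?thesis using 3 by (simp add: DERIV_def)
  qed
qed

definition bump :: "real \<Rightarrow> 'a::euclidean_space \<Rightarrow> real" where
  "bump \<rho> z = max 0 (\<rho>\<^sup>2 - (norm z)\<^sup>2)"

lemma bump_nonneg [simp]: "0 \<le> bump \<rho> z"
  by (simp add: bump_def)

lemma bump_eq_0: "0 \<le> \<rho> \<Longrightarrow> \<rho> \<le> norm z \<Longrightarrow> bump \<rho> z = 0"
  by (simp add: bump_def power_mono)

lemma continuous_on_bump [continuous_intros]:
  "continuous_on S f \<Longrightarrow> continuous_on S (\<lambda>x. bump \<rho> (f x))"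
  unfolding bump_def by (intro continuous_intros)

lemma has_real_derivative_bump_cube:
  fixes z b :: "'a::euclidean_space"
  shows "((\<lambda>t. bump \<rho> (z + t *\<^sub>R b) ^ 3) has_real_derivative - 6 * (bump \<rho> z)\<^sup>2 * (z \<bullet> b)) (at 0)"
proof -
  have eq: "(norm (z + t *\<^sub>R b))\<^sup>2 = (norm z)\<^sup>2 + 2 * (z \<bullet> b) * t + (norm b)\<^sup>2 * t\<^sup>2" for t
    unfolding power2_norm_eq_inner
    by (simp add: inner_add_left inner_add_right inner_commute power2_eq_square[of t] algebra_simps)
  have "((\<lambda>t. \<rho>\<^sup>2 - (norm (z + t *\<^sub>R b))\<^sup>2) has_real_derivative - 2 * (z \<bullet> b)) (at 0)"
    unfolding eq by (auto intro!: derivative_eq_intros)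
  from DERIV_chain2[OF has_real_derivative_pos_part_cube this]
  show ?thesis unfolding bump_def by (simp add: mult_ac)
qed

lemma LINT_lborel_translate:
  fixes f :: "'a::euclidean_space \<Rightarrow> real"
  assumes "f \<in> borel_measurable borel"
  shows "integral\<^sup>L lborel (\<lambda>z. f (c + z)) = integral\<^sup>L lborel f"
proof -
  have "integral\<^sup>L lborel f = integral\<^sup>L (distr lborel borel ((+) c)) f"
    by (simp add: lborel_distr_plus)
  also have "\<dots> = integral\<^sup>L lborel (\<lambda>z. f (c + z))"
    by (rule integral_distr) (use assms in auto)
  finally show ?thesis by simp
qed

lemma integral_cbox_eq_LINT:
  fixes f :: "'a::euclidean_space \<Rightarrow> real"
  assumes f: "continuous_on UNIV f" and supp: "\<And>z. z \<notin> cbox a b \<Longrightarrow> f z = 0"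
  shows "integrable lborel f" "integral (cbox a b) f = integral\<^sup>L lborel f"
proof -
  have "(\<lambda>z. indicator (cbox a b) z *\<^sub>R f z) = f"
    using supp by (fastforce simp: indicator_def)
  moreover have "continuous_on (cbox a b) f"
    using f by (rule continuous_on_subset) simp
  ultimately show int: "integrable lborel f"
    using borel_integrable_compact[of "cbox a b" f] by simp
  have "integral (cbox a b) f = integral UNIV f"
    using supp by (intro integral_spike_set; intro negligible_subset[OF negligible_empty]) auto
  then show "integral (cbox a b) f = integral\<^sup>L lborel f"
    using integral_lborel[OF int] by simp
qed

lemma norm_le_imp_mem_cbox:
  fixes z :: "'a::euclidean_space"
  shows "norm z \<le> c \<Longrightarrow> z \<in> cbox (- c *\<^sub>R One) (c *\<^sub>R One)"
  using Basis_le_norm[of _ z] by (force simp: mem_box abs_le_iff)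

lemma norm_le_mem_cbox:
  fixes z :: "'a::euclidean_space" and c :: real
  assumes "z \<in> cbox (- c *\<^sub>R One) (c *\<^sub>R One)"
  shows "norm z \<le> DIM('a) * c"
proof -
  have "norm z \<le> (\<Sum>b\<in>Basis. \<bar>z \<bullet> b\<bar>)" by (rule norm_le_l1)
  also have "\<dots> \<le> (\<Sum>b\<in>(Basis::'a set). c)"
    using assms by (intro sum_mono) (auto simp: mem_box abs_le_iff)
  finally show ?thesis by simp
qed

text \<open>Integration by parts without boundary terms: translation invariance makes
  \<open>t \<mapsto> \<integral> h (z + t b) dz\<close> constant.\<close>

lemma integral_directional_derivative_eq_0:
  fixes h h1 :: "'a::euclidean_space \<Rightarrow> real"
  assumes h: "continuous_on UNIV h" and h1: "continuous_on UNIV h1"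
    and der: "\<And>z. ((\<lambda>t. h (z + t *\<^sub>R b)) has_real_derivative h1 z) (at 0)"
    and supp: "\<And>z. \<rho> \<le> norm z \<Longrightarrow> h z = 0"
    and b: "norm b \<le> 1"
    and B: "\<And>z. norm z \<le> \<rho> + 1 \<Longrightarrow> z \<in> cbox c d"
  shows "integral (cbox c d) h1 = 0"
proof -
  let ?I = "\<lambda>t. integral (cbox c d) (\<lambda>z. h (z + t *\<^sub>R b))"
  have der': "((\<lambda>t. h (z + t *\<^sub>R b)) has_real_derivative h1 (z + s *\<^sub>R b)) (at s)" for z s
  proof -
    have "((\<lambda>t. h ((z + s *\<^sub>R b) + (t - s) *\<^sub>R b)) has_real_derivative h1 (z + s *\<^sub>R b) * 1) (at s)"
      using der[of "z + s *\<^sub>R b"]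
      by (intro DERIV_chain2[where g = "\<lambda>t. t - s" and f = "\<lambda>t. h ((z + s *\<^sub>R b) + t *\<^sub>R b)"])
         (auto intro!: derivative_eq_intros)
    then show ?thesis by (simp add: algebra_simps)
  qed
  have ci: "continuous_on S (\<lambda>z. h (z + t *\<^sub>R b))" for t S
    by (intro continuous_on_compose2[OF h] continuous_intros) auto
  have "(?I has_real_derivative integral (cbox c d) (\<lambda>z. h1 (z + 0 *\<^sub>R b))) (at 0 within {-1<..<1})"
  proof (rule leibniz_rule_field_derivative)
    fix t z assume "t \<in> {-1<..<1::real}" "z \<in> cbox c d"
    show "((\<lambda>t. h (z + t *\<^sub>R b)) has_real_derivative h1 (z + t *\<^sub>R b)) (at t within {-1<..<1})"
      by (rule has_field_derivative_at_within[OF der'])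
  next
    show "continuous_on ({-1<..<1} \<times> cbox c d) (\<lambda>(t, z). h1 (z + t *\<^sub>R b))"
      unfolding split_beta by (intro continuous_on_compose2[OF h1] continuous_intros) auto
  qed (auto intro!: integrable_continuous ci)
  then have D: "(?I has_real_derivative integral (cbox c d) h1) (at 0)"
    by (simp add: at_within_open[of 0 "{-1<..<1}"])
  have const: "?I t = integral\<^sup>L lborel h" if t: "t \<in> {-1<..<1}" for t
  proof -
    have "h (z + t *\<^sub>R b) = 0" if "z \<notin> cbox c d" for z
    proof -
      have "\<rho> + 1 \<le> norm z" using B[of z] that by linarith
      moreover have "norm z \<le> norm (z + t *\<^sub>R b) + norm (t *\<^sub>R b)"
        using norm_triangle_ineq4[of "z + t *\<^sub>R b" "t *\<^sub>R b"] by simp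
      moreover have "norm (t *\<^sub>R b) \<le> 1"
        using t b mult_mono[of "\<bar>t\<bar>" 1 "norm b" 1] by (auto simp: abs_le_iff)
      ultimately show ?thesis by (intro supp) linarith
    qed
    from integral_cbox_eq_LINT(2)[OF ci this]
    have "?I t = integral\<^sup>L lborel (\<lambda>z. h (z + t *\<^sub>R b))" .
    also have "\<dots> = integral\<^sup>L lborel h"
      using LINT_lborel_translate[of h "t *\<^sub>R b"] borel_measurable_continuous_onI[OF h]
      by (simp add: add.commute)
    finally show ?thesis .
  qed
  have "(?I has_real_derivative 0) (at 0)"
    by (rule has_field_derivative_transform_within_open[of "\<lambda>_. integral\<^sup>L lborel h" _ _ "{-1<..<1}"])
       (auto simp: const)
  with D show ?thesis by (rule DERIV_unique)
qed

lemma continuous_on_mult_cutoff: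
  fixes k V :: "'a::euclidean_space \<Rightarrow> real"
  assumes "continuous_on UNIV k" "continuous_on (ball 0 R) V" "\<rho> < R"
    and "\<And>z. \<rho> \<le> norm z \<Longrightarrow> k z = 0"
  shows "continuous_on UNIV (\<lambda>z. k z * V z)"
proof -
  have "continuous_on (ball 0 R \<union> - cball 0 \<rho>) (\<lambda>z. k z * V z)"
  proof (rule continuous_on_open_Un)
    show "continuous_on (ball 0 R) (\<lambda>z. k z * V z)"
      by (intro continuous_intros assms continuous_on_subset[OF assms(1)]) auto
    show "continuous_on (- cball 0 \<rho>) (\<lambda>z. k z * V z)"
      by (rule continuous_on_eq[OF continuous_on_const[of _ 0]]) (use assms(4) in auto)
  qed auto
  moreover have "ball 0 R \<union> - cball 0 \<rho> = (UNIV :: 'a set)" using assms(3) by auto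
  ultimately show ?thesis by simp
qed

text \<open>Since \<open>\<nabla>(bump\<^sup>3) = - 6 bump\<^sup>2 z\<close>, the average \<open>G (s) = \<integral> 6 bump\<^sup>2 (z) v (x + s z) dz\<close> has
  \<open>G' (s) = s \<integral> bump\<^sup>3 (z) \<Delta>v (x + s z) dz\<close>. The radius of the ball exceeds the support of the kernel so that
  all integrals can be taken over a cube.\<close>

lemma mean_value_inequality:
  fixes v :: "'a::euclidean_space \<Rightarrow> real" and \<sigma> M r \<rho> :: real
  defines "B \<equiv> cbox (- (\<rho> + 1) *\<^sub>R One) ((\<rho> + 1) *\<^sub>R One :: 'a)"
  assumes U: "open U" "C2_on U v" and ball: "ball x (2 * r * (DIM('a) * (\<rho> + 1))) \<subseteq> U"
    and pos: "r > 0" "\<rho> > 0"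
    and lap: "\<And>y. y \<in> ball x (2 * r * (DIM('a) * (\<rho> + 1))) \<Longrightarrow> - M \<le> \<sigma> * laplacian v y"
  shows "\<sigma> * v x * integral B (\<lambda>z. 6 * (bump \<rho> z)\<^sup>2) \<le>
    \<sigma> * integral B (\<lambda>z. 6 * (bump \<rho> z)\<^sup>2 * v (x + r *\<^sub>R z)) + M * r\<^sup>2 / 2 * integral B (\<lambda>z. bump \<rho> z ^ 3)"
proof -
  define D where "D b y = frechet_derivative v (at y) b" for b y
  define D2 where "D2 b y = frechet_derivative (\<lambda>y. frechet_derivative v (at y) b) (at y) b" for b y
  define R where "R = DIM('a) * (\<rho> + 1)"
  define S where "S = {-2 * r<..<2 * r}"
  have Rpos: "R > \<rho>"
  proof -
    have "\<rho> < 1 * (\<rho> + 1)" by simp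
    also have "\<dots> \<le> DIM('a) * (\<rho> + 1)"
      using pos by (intro mult_right_mono) (auto simp: Suc_le_eq)
    finally show ?thesis unfolding R_def .
  qed
  have inball: "x + s *\<^sub>R z \<in> ball x (2 * r * (DIM('a) * (\<rho> + 1)))"
    if "s \<in> S" "norm z \<le> R" for s z
  proof -
    have "\<bar>s\<bar> * norm z \<le> \<bar>s\<bar> * R" using that by (intro mult_left_mono) auto
    also have "\<dots> < 2 * r * R"
      using that Rpos pos by (intro mult_strict_right_mono) (auto simp: S_def abs_less_iff)
    finally show ?thesis by (simp add: dist_norm R_def)
  qed
  have inU: "x + s *\<^sub>R z \<in> U" if "s \<in> S" "norm z \<le> R" for s z
    using inball[OF that] ball by blast
  have BR: "norm z \<le> R" if "z \<in> B" for z
    using norm_le_mem_cbox[of z "\<rho> + 1"] that by (simp add: B_def R_def)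
  have Bmem: "z \<in> B" if "norm z \<le> \<rho> + 1" for z
    using norm_le_imp_mem_cbox[OF that] by (simp add: B_def)
  have line_der: "((\<lambda>s. v (x + s *\<^sub>R z)) has_real_derivative D z (x + s *\<^sub>R z)) (at s)"
    if "s \<in> S" "norm z \<le> R" for s z
    unfolding D_def
    by (rule has_real_derivative_along_line[OF C2_on_differentiable(1)[OF U(2) inU[OF that]]])
  have D_sum: "D z (x + s *\<^sub>R w) = (\<Sum>b\<in>Basis. (z \<bullet> b) * D b (x + s *\<^sub>R w))"
    if "s \<in> S" "norm w \<le> R" for s z w
  proof -
    have lin: "linear (frechet_derivative v (at (x + s *\<^sub>R w)))"
      by (rule linear_frechet_derivative[OF C2_on_differentiable(1)[OF U(2) inU[OF that]]])
    have "frechet_derivative v (at (x + s *\<^sub>R w)) (\<Sum>b\<in>Basis. (z \<bullet> b) *\<^sub>R b) =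
        (\<Sum>b\<in>Basis. (z \<bullet> b) *\<^sub>R frechet_derivative v (at (x + s *\<^sub>R w)) b)"
      by (simp add: linear_sum[OF lin] linear_scale[OF lin])
    then show ?thesis by (simp add: euclidean_representation D_def)
  qed
  define I where "I s = integral B (\<lambda>z. 6 * (bump \<rho> z)\<^sup>2 * v (x + s *\<^sub>R z))" for s
  define I' where "I' s = integral B (\<lambda>z. 6 * (bump \<rho> z)\<^sup>2 * D z (x + s *\<^sub>R z))" for s
  define J where "J = integral B (\<lambda>z::'a. bump \<rho> z ^ 3)"
  have cont_v: "continuous_on B (\<lambda>z. v (x + s *\<^sub>R z))" if "s \<in> S" for s
    by (rule continuous_on_compose2[OF C2_on_continuous(1)[OF U(2)]])
       (auto intro!: continuous_intros inU BR that)
  have I_der: "(I has_real_derivative I' s) (at s)" if s: "s \<in> S" for s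
  proof -
    have "(I has_real_derivative I' s) (at s within S)"
      unfolding I_def[abs_def] I'_def B_def
    proof (rule leibniz_rule_field_derivative)
      fix s z assume s: "s \<in> S" and z: "z \<in> cbox (- (\<rho> + 1) *\<^sub>R One) ((\<rho> + 1) *\<^sub>R One :: 'a)"
      show "((\<lambda>s. 6 * (bump \<rho> z)\<^sup>2 * v (x + s *\<^sub>R z)) has_real_derivative
          6 * (bump \<rho> z)\<^sup>2 * D z (x + s *\<^sub>R z)) (at s within S)"
        using z by (intro DERIV_cmult has_field_derivative_at_within[OF line_der[OF s BR]])
          (simp add: B_def)
    next
      have "continuous_on (S \<times> B) (\<lambda>(s, z). 6 * (bump \<rho> z)\<^sup>2 * (\<Sum>b\<in>Basis. (z \<bullet> b) * D b (x + s *\<^sub>R z)))"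
        unfolding split_beta D_def
        by (intro continuous_intros continuous_on_compose2[OF C2_on_continuous(2)[OF U(2)]])
           (auto intro!: inU BR)
      then show "continuous_on (S \<times> cbox (- (\<rho> + 1) *\<^sub>R One) ((\<rho> + 1) *\<^sub>R One))
         (\<lambda>(s, z). 6 * (bump \<rho> z)\<^sup>2 * D z (x + s *\<^sub>R z))"
        unfolding B_def[symmetric]
        by (rule continuous_on_eq) (auto simp: D_sum BR)
    next
      fix s assume "s \<in> S"
      then show "(\<lambda>z. 6 * (bump \<rho> z)\<^sup>2 * v (x + s *\<^sub>R z)) integrable_on
          cbox (- (\<rho> + 1) *\<^sub>R One) ((\<rho> + 1) *\<^sub>R One)"
        by (intro integrable_continuous continuous_intros cont_v[unfolded B_def])
    qed (use s in \<open>auto simp: S_def\<close>)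
    moreover have "open S" by (simp add: S_def)
    ultimately show ?thesis using s by (simp only: at_within_open)
  qed
  have I'_eq: "I' s = s * integral B (\<lambda>z. bump \<rho> z ^ 3 * laplacian v (x + s *\<^sub>R z))" if s: "s \<in> S" for s
  proof -
    define h1 where "h1 b z = (- 6 * (bump \<rho> z)\<^sup>2 * (z \<bullet> b)) * D b (x + s *\<^sub>R z)
        + (bump \<rho> z ^ 3 * s) * D2 b (x + s *\<^sub>R z)" for b z
    have cD: "continuous_on (ball 0 R) (\<lambda>z. D b (x + s *\<^sub>R z))" for b
      unfolding D_def
      by (rule continuous_on_compose2[OF C2_on_continuous(2)[OF U(2)]])
         (auto intro!: continuous_intros inU s)
    have cD2: "continuous_on (ball 0 R) (\<lambda>z. D2 b (x + s *\<^sub>R z))" for b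
      unfolding D2_def
      by (rule continuous_on_compose2[OF C2_on_continuous(3)[OF U(2)]])
         (auto intro!: continuous_intros inU s)
    have ch1: "continuous_on UNIV (h1 b)" for b
      unfolding h1_def using pos
      by (intro continuous_on_add continuous_on_mult_cutoff[OF _ cD Rpos] continuous_on_mult_cutoff[OF _ cD2 Rpos])
         (auto intro!: continuous_intros simp: bump_eq_0)
    have zero: "integral B (h1 b) = 0" if b: "b \<in> Basis" for b
      unfolding B_def
    proof (rule integral_directional_derivative_eq_0[where h = "\<lambda>z. bump \<rho> z ^ 3 * D b (x + s *\<^sub>R z)"])
      show "continuous_on UNIV (\<lambda>z. bump \<rho> z ^ 3 * D b (x + s *\<^sub>R z))"
        using pos by (intro continuous_on_mult_cutoff[OF _ cD Rpos])
          (auto intro!: continuous_intros simp: bump_eq_0)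
      show "((\<lambda>t. bump \<rho> (z + t *\<^sub>R b) ^ 3 * D b (x + s *\<^sub>R (z + t *\<^sub>R b))) has_real_derivative h1 b z) (at 0)" for z
      proof (cases "norm z < R")
        case True
        have "(\<lambda>y. frechet_derivative v (at y) b) differentiable (at (x + s *\<^sub>R z))"
          using C2_on_differentiable(2)[OF U(2) inU[OF s]] True by simp
        then have "((\<lambda>y. D b y) has_derivative frechet_derivative (D b) (at (x + s *\<^sub>R z))) (at (x + s *\<^sub>R z))"
          by (simp add: frechet_derivative_works D_def[abs_def])
        then have hd: "(D b has_derivative frechet_derivative (D b) (at (x + s *\<^sub>R z))) (at (x + s *\<^sub>R (z + 0 *\<^sub>R b)))"
          by simp
        have "((\<lambda>t. D b (x + s *\<^sub>R (z + t *\<^sub>R b))) has_derivative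
            (\<lambda>t. frechet_derivative (D b) (at (x + s *\<^sub>R z)) (s *\<^sub>R t *\<^sub>R b))) (at 0)"
          by (rule has_derivative_compose[where f = "\<lambda>t. x + s *\<^sub>R (z + t *\<^sub>R b)" and g = "D b", OF _ hd])
             (auto intro!: derivative_eq_intros)
        moreover have "frechet_derivative (D b) (at (x + s *\<^sub>R z)) (s *\<^sub>R t *\<^sub>R b) = s * D2 b (x + s *\<^sub>R z) * t" for t
          using linear_scale[OF has_derivative_linear[OF hd]]
          by (simp add: D2_def D_def[abs_def])
        ultimately have 2: "((\<lambda>t. D b (x + s *\<^sub>R (z + t *\<^sub>R b))) has_real_derivative s * D2 b (x + s *\<^sub>R z)) (at 0)"
          by (simp add: has_field_derivative_def)
        show ?thesis
          by (rule DERIV_cong[OF DERIV_mult[OF has_real_derivative_bump_cube 2]])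
             (simp add: h1_def)
      next
        case False
        then have far: "norm z > \<rho>" using Rpos by simp
        have "((\<lambda>t. 0) has_real_derivative h1 b z) (at (0::real))"
          using far pos by (simp add: h1_def bump_eq_0)
        moreover have "open {t. norm (z + t *\<^sub>R b) > \<rho>}"
          by (intro open_Collect_less continuous_intros)
        ultimately show ?thesis
          by (rule has_field_derivative_transform_within_open) (use far pos in \<open>auto simp: bump_eq_0\<close>)
      qed
    qed (use pos b ch1 Bmem in \<open>auto simp: bump_eq_0 B_def\<close>)
    have int_h1: "h1 b integrable_on B" for b
      unfolding B_def by (rule integrable_continuous[OF continuous_on_subset[OF ch1]]) auto
    have i1: "(\<lambda>z. 6 * (bump \<rho> z)\<^sup>2 * D z (x + s *\<^sub>R z)) integrable_on B"
    proof -
      have "continuous_on B (\<lambda>z. 6 * (bump \<rho> z)\<^sup>2 * (\<Sum>b\<in>Basis. (z \<bullet> b) * D b (x + s *\<^sub>R z)))"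
        unfolding D_def
        by (intro continuous_intros continuous_on_compose2[OF C2_on_continuous(2)[OF U(2)]])
           (auto intro!: inU BR s)
      then have "continuous_on B (\<lambda>z. 6 * (bump \<rho> z)\<^sup>2 * D z (x + s *\<^sub>R z))"
        by (rule continuous_on_eq) (auto simp: D_sum BR s)
      then show ?thesis unfolding B_def by (rule integrable_continuous)
    qed
    have i2: "(\<lambda>z. s * (bump \<rho> z ^ 3 * laplacian v (x + s *\<^sub>R z))) integrable_on B"
    proof -
      have "continuous_on B (\<lambda>z. s * (bump \<rho> z ^ 3 * laplacian v (x + s *\<^sub>R z)))"
        by (intro continuous_intros continuous_on_compose2[OF C2_on_laplacian_continuous[OF U(2)]])
           (auto intro!: inU BR s)
      then show ?thesis unfolding B_def by (rule integrable_continuous)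
    qed
    have "0 = (\<Sum>b\<in>Basis. integral B (h1 b))" by (simp add: zero)
    also have "\<dots> = integral B (\<lambda>z. \<Sum>b\<in>Basis. h1 b z)"
      by (rule integral_sum[symmetric]) (auto intro: int_h1)
    also have "\<dots> = integral B (\<lambda>z. s * (bump \<rho> z ^ 3 * laplacian v (x + s *\<^sub>R z)) - 6 * (bump \<rho> z)\<^sup>2 * D z (x + s *\<^sub>R z))"
    proof (rule integral_cong)
      fix z assume "z \<in> B"
      then have "D z (x + s *\<^sub>R z) = (\<Sum>b\<in>Basis. (z \<bullet> b) * D b (x + s *\<^sub>R z))"
        by (intro D_sum[OF s] BR)
      then show "(\<Sum>b\<in>Basis. h1 b z) =
         s * (bump \<rho> z ^ 3 * laplacian v (x + s *\<^sub>R z)) - 6 * (bump \<rho> z)\<^sup>2 * D z (x + s *\<^sub>R z)"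
        by (simp add: h1_def laplacian_def D2_def sum_subtractf sum.distrib sum_distrib_left sum_negf mult_ac)
    qed
    also have "\<dots> = integral B (\<lambda>z. s * (bump \<rho> z ^ 3 * laplacian v (x + s *\<^sub>R z))) - I' s"
      unfolding I'_def by (rule integral_diff[OF i2 i1])
    finally show ?thesis by simp
  qed
  have I'_ge: "- (s * M * J) \<le> \<sigma> * I' s" if s: "s \<in> S" "0 \<le> s" for s
  proof -
    have c1: "continuous_on B (\<lambda>z. bump \<rho> z ^ 3 * laplacian v (x + s *\<^sub>R z))"
      by (intro continuous_intros continuous_on_compose2[OF C2_on_laplacian_continuous[OF U(2)]])
         (auto intro!: inU BR s)
    have "- M * J = integral B (\<lambda>z::'a. - M * bump \<rho> z ^ 3)" by (simp add: J_def)
    also have "\<dots> \<le> integral B (\<lambda>z. \<sigma> * (bump \<rho> z ^ 3 * laplacian v (x + s *\<^sub>R z)))"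
    proof (rule integral_le)
      show "(\<lambda>z::'a. - M * bump \<rho> z ^ 3) integrable_on B"
        unfolding B_def by (intro integrable_continuous continuous_intros)
      show "(\<lambda>z. \<sigma> * (bump \<rho> z ^ 3 * laplacian v (x + s *\<^sub>R z))) integrable_on B"
        using c1 unfolding B_def by (intro integrable_continuous continuous_on_mult_left)
      fix z assume "z \<in> B"
      then have "bump \<rho> z ^ 3 * (- M) \<le> bump \<rho> z ^ 3 * (\<sigma> * laplacian v (x + s *\<^sub>R z))"
        by (intro mult_left_mono lap inball s BR) auto
      then show "- M * bump \<rho> z ^ 3 \<le> \<sigma> * (bump \<rho> z ^ 3 * laplacian v (x + s *\<^sub>R z))"
        by (simp add: mult_ac)
    qed
    finally have "s * (- M * J) \<le> s * (\<sigma> * integral B (\<lambda>z. bump \<rho> z ^ 3 * laplacian v (x + s *\<^sub>R z)))"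
      using s(2) by (intro mult_left_mono) auto
    then show ?thesis by (simp add: I'_eq[OF s(1)] mult_ac)
  qed
  have "\<sigma> * I 0 + M * J * 0\<^sup>2 / 2 \<le> \<sigma> * I r + M * J * r\<^sup>2 / 2"
  proof (rule DERIV_nonneg_imp_nondecreasing[where f = "\<lambda>s. \<sigma> * I s + M * J * s\<^sup>2 / 2"])
    fix s assume s: "0 \<le> s" "s \<le> r"
    then have sS: "s \<in> S" using pos by (simp add: S_def)
    have "((\<lambda>s. \<sigma> * I s + M * J * s\<^sup>2 / 2) has_real_derivative \<sigma> * I' s + M * J * s) (at s)"
      by (rule DERIV_add[OF DERIV_cmult[OF I_der[OF sS]]]) (auto intro!: derivative_eq_intros)
    moreover have "0 \<le> \<sigma> * I' s + M * J * s" using I'_ge[OF sS s(1)] by (simp add: mult_ac)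
    ultimately show "\<exists>y. ((\<lambda>s. \<sigma> * I s + M * J * s\<^sup>2 / 2) has_real_derivative y) (at s) \<and> 0 \<le> y" by blast
  qed (use pos in simp)
  moreover have "I 0 = v x * integral B (\<lambda>z. 6 * (bump \<rho> z)\<^sup>2)"
    by (simp add: I_def mult.commute)
  ultimately show ?thesis by (simp add: I_def J_def mult_ac)
qed

section \<open>The Harnack inequality\<close>

definition singular_solution :: "real \<Rightarrow> 'a::euclidean_space set \<Rightarrow> ('a \<Rightarrow> real) \<Rightarrow> bool" where
  "singular_solution \<gamma> U u \<longleftrightarrow> open U \<and> C2_on U u \<and>
     (\<forall>x\<in>U. 0 < u x \<and> - laplacian u x = u x powr (- \<gamma>))"

lemma singular_solutionD:
  assumes "singular_solution \<gamma> U u"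
  shows "open U" "C2_on U u" "x \<in> U \<Longrightarrow> 0 < u x" "x \<in> U \<Longrightarrow> laplacian u x = - (u x powr (- \<gamma>))"
  using assms by (auto simp: singular_solution_def minus_equation_iff)

text \<open>The constant \<open>c\<close> with \<open>2 n c = c\<^sup>-\<^sup>\<gamma>\<close>, for which \<open>c d\<^sup>\<phi>\<^sup>-\<^sup>2 (d\<^sup>2 - |y|\<^sup>2)\<close> is a subsolution in the ball of radius \<open>d\<close>.\<close>

definition ball_const :: "'a::euclidean_space itself \<Rightarrow> real \<Rightarrow> real" where
  "ball_const _ \<gamma> = (1 / (2 * DIM('a))) powr (1 / (1 + \<gamma>))"

lemma ball_const_pos: "0 < ball_const TYPE('a::euclidean_space) \<gamma>"
  by (simp add: ball_const_def)

lemma ball_const_powr: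
  assumes "\<gamma> > 0"
  shows "2 * DIM('a) * ball_const TYPE('a::euclidean_space) \<gamma> = ball_const TYPE('a) \<gamma> powr (- \<gamma>)"
proof -
  let ?c = "ball_const TYPE('a) \<gamma>"
  have "?c powr (1 + \<gamma>) = 1 / (2 * DIM('a))"
    using assms by (simp add: ball_const_def powr_powr)
  moreover have "?c powr (1 + \<gamma>) = ?c * ?c powr \<gamma>"
    using ball_const_pos[of \<gamma>, where 'a = 'a] by (simp add: powr_add)
  ultimately have "?c * ?c powr \<gamma> = 1 / (2 * DIM('a))" by simp
  then show ?thesis
    using ball_const_pos[of \<gamma>, where 'a = 'a] by (simp add: powr_minus field_simps)
qed

lemma scaling_exponent:
  fixes \<gamma> \<phi> :: real
  assumes "\<gamma> > 0" "\<phi> = 2 / (1 + \<gamma>)"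
  shows "\<phi> * - \<gamma> = \<phi> - 2"
  using assms by (simp add: field_simps)

lemma solution_ge_dist_powr:
  fixes u :: "'a::euclidean_space \<Rightarrow> real"
  assumes sol: "singular_solution \<gamma> U u" and \<gamma>: "\<gamma> > 0" and \<phi>: "\<phi> = 2 / (1 + \<gamma>)"
    and d: "d > 0" "cball y d \<subseteq> U"
  shows "ball_const TYPE('a) \<gamma> * d powr \<phi> \<le> u y"
proof -
  note S = singular_solutionD[OF sol]
  define c where "c = ball_const TYPE('a) \<gamma>"
  define k where "k = c * d powr (\<phi> - 2)"
  have c: "c > 0" by (simp add: c_def ball_const_pos)
  have k: "k > 0" using c d by (simp add: k_def)
  have kd: "k * d\<^sup>2 = c * d powr \<phi>"
    using d by (simp add: k_def powr_diff powr_numeral field_simps)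
  have "- 1 * u y \<le> - 1 * (k * (d\<^sup>2 - (norm (y - y))\<^sup>2))"
  proof (rule radial_comparison[where D = "cball y d" and T = UNIV and F = "\<lambda>a. k * (d\<^sup>2 - a)" and \<sigma> = "-1"
        and p = y and ?F1.0 = "\<lambda>_. - k" and ?F2.0 = "\<lambda>_. 0", OF S(1,2)])
    show "continuous_on (cball y d) u"
      using C2_on_continuous(1)[OF S(2)] d(2) by (rule continuous_on_subset)
    fix x assume x: "x \<in> cball y d" and "- 1 * (k * (d\<^sup>2 - (norm (x - y))\<^sup>2)) < - 1 * u x"
    then have less: "u x < k * (d\<^sup>2 - (norm (x - y))\<^sup>2)" by simp
    have xU: "x \<in> U" using x d by auto
    have "0 < k * (d\<^sup>2 - (norm (x - y))\<^sup>2)" using less S(3)[OF xU] by linarith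
    then have "(norm (x - y))\<^sup>2 < d\<^sup>2" using k by (simp add: zero_less_mult_iff)
    then have "norm (x - y) < d" using d by (simp add: power2_less_imp_less)
    then have int: "x \<in> interior (cball y d)" by (simp add: dist_norm norm_minus_commute)
    have "u x < k * d\<^sup>2"
      using less k by (smt (verit) mult_left_mono zero_le_power2)
    then have ux: "u x < c * d powr \<phi>" by (simp add: kd)
    have "2 * DIM('a) * k = c powr (- \<gamma>) * d powr (\<phi> - 2)"
      using ball_const_powr[OF \<gamma>, where 'a = 'a] by (simp add: k_def c_def mult.assoc[symmetric])
    also have "\<dots> = (c * d powr \<phi>) powr (- \<gamma>)"
      using c d scaling_exponent[OF \<gamma> \<phi>] by (simp add: powr_mult powr_powr)
    also have "\<dots> < u x powr (- \<gamma>)"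
      using \<gamma> S(3)[OF xU] ux by (intro powr_less_mono2_neg) auto
    finally show "x \<in> U \<and> x \<in> interior (cball y d) \<and> (norm (x - y))\<^sup>2 \<in> UNIV \<and>
      - 1 * (4 * (norm (x - y))\<^sup>2 * 0 + 2 * DIM('a) * - k) < - 1 * laplacian u x"
      using xU int S(4)[OF xU] by simp
  qed (use d in \<open>auto intro!: continuous_intros derivative_eq_intros\<close>)
  then show ?thesis using kd by (simp add: c_def)
qed

lemma integral_bump_square_pos:
  fixes B :: "'a::euclidean_space set"
  assumes \<rho>: "\<rho> > 0" and B: "B = cbox (- (\<rho> + 1) *\<^sub>R One) ((\<rho> + 1) *\<^sub>R One)"
  shows "0 < integral B (\<lambda>z. 6 * (bump \<rho> z)\<^sup>2)"
proof (rule ccontr)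
  let ?f = "\<lambda>z::'a. 6 * (bump \<rho> z)\<^sup>2"
  assume neg: "\<not> 0 < integral B ?f"
  have c: "continuous_on B ?f" by (intro continuous_intros)
  have i: "?f integrable_on B" using c unfolding B by (rule integrable_continuous)
  have "0 \<le> integral B ?f" by (rule integral_nonneg[OF i]) simp
  with neg have "(?f has_integral 0) B" using i by (metis antisym_conv2 integrable_integral)
  moreover have "box (- (\<rho> + 1) *\<^sub>R One) ((\<rho> + 1) *\<^sub>R One :: 'a) \<noteq> {}"
    using \<rho> by (simp add: box_ne_empty)
  moreover have "0 \<in> B" unfolding B using \<rho> by (intro norm_le_imp_mem_cbox) simp
  ultimately have "?f 0 = 0"
    using c unfolding B by (intro has_integral_0_cbox_imp_0[where f = ?f]) auto
  then show False using \<rho> by (simp add: bump_def)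
qed

lemma bump_square_translate_le:
  assumes "norm e \<le> 1"
  shows "(bump 1 (e + z))\<^sup>2 \<le> (bump 4 z)\<^sup>2" and "2 \<le> norm z \<Longrightarrow> bump 1 (e + z) = 0"
proof -
  have tri: "norm z \<le> norm (e + z) + norm e" by (metis add_diff_cancel_left' norm_triangle_ineq4 add.commute)
  show zero: "bump 1 (e + z) = 0" if "2 \<le> norm z"
    using tri that assms by (intro bump_eq_0) auto
  show "(bump 1 (e + z))\<^sup>2 \<le> (bump 4 z)\<^sup>2"
  proof (cases "2 \<le> norm z")
    case False
    then have "(norm z)\<^sup>2 \<le> 2\<^sup>2" by (intro power_mono) auto
    then have "1 \<le> bump 4 z" by (simp add: bump_def)
    moreover have "bump 1 (e + z) \<le> 1" by (simp add: bump_def)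
    ultimately show ?thesis by (intro power_mono) auto
  qed (simp add: zero)
qed

lemma solution_harnack:
  assumes \<gamma>: "\<gamma> > 0"
  obtains H \<Lambda> :: real where "H \<ge> 1" "\<Lambda> \<ge> 1"
    "\<And>U u x y r. singular_solution \<gamma> U u \<Longrightarrow> r > 0 \<Longrightarrow> ball x (\<Lambda> * r) \<subseteq> U \<Longrightarrow>
       dist x y \<le> r \<Longrightarrow> u (x::'a::euclidean_space) \<le> H * u y"
proof -
  define c where "c = ball_const TYPE('a) \<gamma>"
  define n :: real where "n = DIM('a)"
  have n: "n \<ge> 1" by (simp add: n_def Suc_le_eq)
  define B where "B \<rho> = cbox (- (\<rho> + 1) *\<^sub>R One) ((\<rho> + 1) *\<^sub>R One :: 'a)" for \<rho> :: real
  define a where "a \<rho> = integral (B \<rho>) (\<lambda>z::'a. 6 * (bump \<rho> z)\<^sup>2)" for \<rho>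
  define b where "b = integral (B 1) (\<lambda>z::'a. bump 1 z ^ 3)"
  have c: "c > 0" by (simp add: c_def ball_const_pos)
  have a: "a \<rho> > 0" if "\<rho> > 0" for \<rho>
    using that unfolding a_def B_def by (intro integral_bump_square_pos) auto
  have b: "b \<ge> 0"
    unfolding b_def B_def by (intro integral_nonneg integrable_continuous continuous_intros) simp
  define H where "H = max 1 ((a 4 + c powr (- \<gamma>) / c * b / 2) / a 1)"
  define \<Lambda> where "\<Lambda> = 11 * n"
  show ?thesis
  proof
    show "H \<ge> 1" "\<Lambda> \<ge> 1" using n by (auto simp: H_def \<Lambda>_def)
    fix U :: "'a set" and u x y and r :: real
    assume sol: "singular_solution \<gamma> U u" and r: "r > 0" and sub: "ball x (\<Lambda> * r) \<subseteq> U"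
      and xy: "dist x y \<le> r"
    note S = singular_solutionD[OF sol]
    define \<phi> where "\<phi> = 2 / (1 + \<gamma>)"
    have nr: "n * r \<ge> r" using mult_right_mono[OF n, of r] r by simp
    have nr0: "n * r > 0" using nr r by linarith
    have xy4: "dist x y < 4 * (n * r)" using xy nr nr0 by linarith
    have subU: "z \<in> U" if "dist x z < 11 * (n * r)" for z
      using sub that by (auto simp: \<Lambda>_def mult.assoc)
    have sub4: "z \<in> U" if "dist x z < 4 * (n * r)" for z
      using that nr0 by (intro subU) linarith
    have low: "c * r powr \<phi> \<le> u z" if "dist x z < 4 * (n * r)" for z
    proof -
      have "cball z r \<subseteq> U"
      proof
        fix w assume "w \<in> cball z r"
        then have "dist z w \<le> r" by simp
        then show "w \<in> U" using dist_triangle[of x w z] that nr r by (intro subU) linarith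
      qed
      then show ?thesis unfolding c_def by (intro solution_ge_dist_powr[OF sol \<gamma> \<phi>_def r])
    qed
    define M where "M = (c * r powr \<phi>) powr (- \<gamma>)"
    have ball1: "ball x (2 * r * (DIM('a) * (1 + 1 :: real))) = ball x (4 * (n * r))"
      and ball4: "ball y (2 * r * (DIM('a) * (4 + 1 :: real))) = ball y (10 * (n * r))"
      by (auto simp: n_def mult_ac)
    have in4: "z \<in> U" if "dist y z < 10 * (n * r)" for z
      using dist_triangle[of x z y] that xy nr by (intro subU) linarith
    have mv1: "1 * u x * a 1 \<le> 1 * integral (B 1) (\<lambda>z. 6 * (bump 1 z)\<^sup>2 * u (x + r *\<^sub>R z)) + M * r\<^sup>2 / 2 * b"
      unfolding a_def b_def B_def
    proof (rule mean_value_inequality[OF S(1,2)], unfold ball1)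
      show "ball x (4 * (n * r)) \<subseteq> U" by (auto intro!: sub4)
      fix z assume z: "z \<in> ball x (4 * (n * r))"
      then have zU: "z \<in> U" by (auto intro!: sub4)
      have "u z powr (- \<gamma>) \<le> M"
        unfolding M_def using \<gamma> c r z low[of z] by (intro powr_mono2') auto
      then show "- M \<le> 1 * laplacian u z" using S(4)[OF zU] by simp
    qed (use r in auto)
    have "- 1 * u y * a 4 \<le> - 1 * integral (B 4) (\<lambda>z. 6 * (bump 4 z)\<^sup>2 * u (y + r *\<^sub>R z)) + 0 * r\<^sup>2 / 2 * integral (B 4) (\<lambda>z. bump 4 z ^ 3)"
      unfolding a_def B_def
    proof (rule mean_value_inequality[OF S(1,2)], unfold ball4)
      show "ball y (10 * (n * r)) \<subseteq> U" using in4 by auto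
      fix z assume "z \<in> ball y (10 * (n * r))"
      then show "- 0 \<le> - 1 * laplacian u z" using S(4)[OF in4] by simp
    qed (use r in auto)
    then have mv4: "integral (B 4) (\<lambda>z. 6 * (bump 4 z)\<^sup>2 * u (y + r *\<^sub>R z)) \<le> u y * a 4" by simp
    define f where "f \<rho> p z = 6 * (bump \<rho> z)\<^sup>2 * u (p + r *\<^sub>R z)" for \<rho> p and z :: 'a
    have inU1: "x + r *\<^sub>R z \<in> U" if "norm z < 3" for z
    proof (rule subU)
      have "dist x (x + r *\<^sub>R z) = r * norm z" using r by (simp add: dist_norm)
      also have "\<dots> < r * 3" using that r by (intro mult_strict_left_mono) auto
      finally show "dist x (x + r *\<^sub>R z) < 11 * (n * r)" using nr nr0 by linarith
    qed
    have inU4: "y + r *\<^sub>R z \<in> U" if "norm z < 5" for z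
    proof (rule in4)
      have "dist y (y + r *\<^sub>R z) = r * norm z" using r by (simp add: dist_norm)
      also have "\<dots> < r * 5" using that r by (intro mult_strict_left_mono) auto
      finally show "dist y (y + r *\<^sub>R z) < 10 * (n * r)" using nr nr0 by linarith
    qed
    have cont1: "continuous_on UNIV (f 1 x)" unfolding f_def
      by (rule continuous_on_mult_cutoff[where \<rho> = 1 and R = 3])
         (auto intro!: continuous_intros continuous_on_compose2[OF C2_on_continuous(1)[OF S(2)]] inU1 simp: bump_eq_0)
    have cont4: "continuous_on UNIV (f 4 y)" unfolding f_def
      by (rule continuous_on_mult_cutoff[where \<rho> = 4 and R = 5])
         (auto intro!: continuous_intros continuous_on_compose2[OF C2_on_continuous(1)[OF S(2)]] inU4 simp: bump_eq_0)
    have supp: "f \<rho> p z = 0" if "z \<notin> B \<rho>" "\<rho> \<ge> 0" for \<rho> p z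
    proof -
      have "\<rho> \<le> norm z" using that norm_le_imp_mem_cbox[of z "\<rho> + 1"] by (force simp: B_def)
      then show ?thesis using that(2) by (simp add: f_def bump_eq_0)
    qed
    have I1: "integral (B 1) (f 1 x) = integral\<^sup>L lborel (f 1 x)"
      using supp unfolding B_def by (intro integral_cbox_eq_LINT cont1) auto
    have I4: "integral (B 4) (f 4 y) = integral\<^sup>L lborel (f 4 y)" and int4: "integrable lborel (f 4 y)"
      using supp unfolding B_def by (intro integral_cbox_eq_LINT[where a = "- (4 + 1) *\<^sub>R One" and b = "(4 + 1) *\<^sub>R One"] cont4; auto)+
    define e where "e = (1 / r) *\<^sub>R (y - x)"
    have e: "norm e \<le> 1" using xy r by (simp add: e_def dist_norm norm_minus_commute)
    have xe: "x + r *\<^sub>R (e + z) = y + r *\<^sub>R z" for z using r by (simp add: e_def algebra_simps)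
    have le: "f 1 x (e + z) \<le> f 4 y z" for z
    proof (cases "norm z < 5")
      case True
      then show ?thesis
        using bump_square_translate_le(1)[OF e, of z] S(3)[OF inU4[OF True]]
        by (simp add: f_def xe)
    next
      case False
      then show ?thesis using bump_square_translate_le(2)[OF e, of z] by (simp add: f_def bump_eq_0)
    qed
    have "integral\<^sup>L lborel (f 1 x) = integral\<^sup>L lborel (\<lambda>z. f 1 x (e + z))"
      using borel_measurable_continuous_onI[OF cont1] by (intro LINT_lborel_translate[symmetric])
    also have "\<dots> \<le> integral\<^sup>L lborel (f 4 y)"
    proof (rule integral_mono[OF _ int4 le])
      show "integrable lborel (\<lambda>z. f 1 x (e + z))"
      proof (rule integral_cbox_eq_LINT(1))
        show "continuous_on UNIV (\<lambda>z. f 1 x (e + z))"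
          by (intro continuous_on_compose2[OF cont1] continuous_intros) auto
        fix z :: 'a assume "z \<notin> cbox (- 2 *\<^sub>R One) (2 *\<^sub>R One)"
        then have "2 \<le> norm z" using norm_le_imp_mem_cbox[of z 2] by force
        then show "f 1 x (e + z) = 0" using bump_square_translate_le(2)[OF e] by (simp add: f_def)
      qed
    qed
    finally have "integral (B 1) (f 1 x) \<le> u y * a 4" using I1 I4 mv4 by (simp add: f_def[abs_def])
    with mv1 have 1: "u x * a 1 \<le> u y * a 4 + M * r\<^sup>2 / 2 * b" by (simp add: f_def[abs_def])
    have "M * r\<^sup>2 = c powr (- \<gamma>) * r powr \<phi>"
      using c r scaling_exponent[OF \<gamma> \<phi>_def]
      by (simp add: M_def powr_mult powr_powr powr_diff powr_numeral)
    also have "\<dots> = c powr (- \<gamma>) / c * (c * r powr \<phi>)" using c by simp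
    also have "\<dots> \<le> c powr (- \<gamma>) / c * u y"
      using c by (intro mult_left_mono low xy4) auto
    finally have "M * r\<^sup>2 / 2 * b \<le> (c powr (- \<gamma>) / c * u y) / 2 * b"
      using b by (intro mult_right_mono divide_right_mono) auto
    with 1 have "u x * a 1 \<le> (a 4 + c powr (- \<gamma>) / c * b / 2) * u y" by (simp add: algebra_simps)
    then have "u x \<le> (a 4 + c powr (- \<gamma>) / c * b / 2) / a 1 * u y"
      using a[of 1] by (simp add: field_simps)
    also have "\<dots> \<le> H * u y"
      using S(3)[OF sub4[OF xy4]] by (intro mult_right_mono) (auto simp: H_def)
    finally show "u x \<le> H * u y" .
  qed
qed

definition above_graph :: "('a::euclidean_space \<Rightarrow> real) \<Rightarrow> ('a \<times> real) set" where
  "above_graph g = {y. norm (fst y) < 20 \<and> g (fst y) < snd y \<and> snd y < g (fst y) + 20}"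

section \<open>Solutions above a graph\<close>

text \<open>All that is used of the pinching by spheres of radius \<open>1 / K\<close>: the graph is nearly flat, and it lies
  between the two unit spheres tangent to it at the origin.\<close>

definition tangent_solution ::
    "real \<Rightarrow> real \<Rightarrow> ('a::euclidean_space \<Rightarrow> real) \<Rightarrow> ('a \<times> real \<Rightarrow> real) \<Rightarrow> bool" where
  "tangent_solution \<gamma> L g u \<longleftrightarrow>
     (\<forall>x\<in>ball 0 20. \<forall>y\<in>ball 0 20. \<bar>g x - g y\<bar> \<le> L * dist x y) \<and>
     (\<forall>x\<in>ball 0 20. \<bar>g x\<bar> \<le> 1 / 4) \<and>
     (\<forall>x. norm x \<le> 1 \<longrightarrow> \<bar>g x\<bar> \<le> 1 - sqrt (1 - (norm x)\<^sup>2)) \<and>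
     singular_solution \<gamma> (above_graph g) u \<and>
     continuous_on (above_graph g \<union> graph_over (ball 0 20) g) u \<and>
     (\<forall>y\<in>graph_over (ball 0 20) g. u y = 0)"

lemma tangent_solutionD:
  assumes "tangent_solution \<gamma> L g u"
  shows "norm x < 20 \<Longrightarrow> norm y < 20 \<Longrightarrow> \<bar>g x - g y\<bar> \<le> L * norm (x - y)"
    and "norm x < 20 \<Longrightarrow> \<bar>g x\<bar> \<le> 1 / 4"
    and "norm x \<le> 1 \<Longrightarrow> \<bar>g x\<bar> \<le> 1 - sqrt (1 - (norm x)\<^sup>2)"
    and "singular_solution \<gamma> (above_graph g) u"
    and "continuous_on (above_graph g \<union> graph_over (ball 0 20) g) u"
    and "norm x < 20 \<Longrightarrow> u (x, g x) = 0"
  using assms unfolding tangent_solution_def by (auto simp: dist_norm graph_over_def)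

lemma norm_components_le:
  fixes y :: "'a::real_normed_vector \<times> real"
  shows "norm (fst y) \<le> norm y" "\<bar>snd y\<bar> \<le> norm y"
  using norm_fst_le[of "fst y" "snd y"] norm_snd_le[of "snd y" "fst y"] by simp_all

lemma tangent_solution_mem:
  assumes sol: "tangent_solution \<gamma> L g u" and y: "norm y \<le> 10" "g (fst y) \<le> snd y"
  shows "y \<in> above_graph g \<or> u y = 0" "y \<in> above_graph g \<union> graph_over (ball 0 20) g"
proof -
  have "norm (fst y) \<le> 10" "\<bar>snd y\<bar> \<le> 10"
    using norm_components_le(1)[of y] norm_components_le(2)[of y] y by linarith+
  moreover have "\<bar>g (fst y)\<bar> \<le> 1 / 4"
    using tangent_solutionD(2)[OF sol] calculation by simp
  ultimately have "y \<in> above_graph g \<or> (norm (fst y) < 20 \<and> snd y = g (fst y))"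
    using y by (cases "snd y = g (fst y)") (auto simp: above_graph_def abs_le_iff)
  then show "y \<in> above_graph g \<or> u y = 0" "y \<in> above_graph g \<union> graph_over (ball 0 20) g"
    using tangent_solutionD(6)[OF sol, of "fst y"] by (cases y; auto simp: graph_over_def)+
qed

lemma abs_diff_le_dist_imp_continuous_on:
  fixes g :: "'a::metric_space \<Rightarrow> real"
  assumes "\<And>x y. x \<in> S \<Longrightarrow> y \<in> S \<Longrightarrow> \<bar>g x - g y\<bar> \<le> L * dist x y"
  shows "continuous_on S g"
proof (rule lipschitz_on_continuous_on)
  show "(max 0 L)-lipschitz_on S g"
  proof (rule lipschitz_onI)
    fix x y assume "x \<in> S" "y \<in> S"
    then have "\<bar>g x - g y\<bar> \<le> L * dist x y" by (rule assms)
    also have "\<dots> \<le> max 0 L * dist x y" by (intro mult_right_mono) auto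
    finally show "dist (g x) (g y) \<le> max 0 L * dist x y" by (simp add: dist_real_def)
  qed simp
qed

lemma tangent_solution_compact:
  assumes sol: "tangent_solution \<gamma> L g u" and c: "norm c + s \<le> 10"
  shows "compact {x \<in> cball c s. g (fst x) \<le> snd x}"
    and "continuous_on {x \<in> cball c s. g (fst x) \<le> snd x} u"
    and "above_graph g \<inter> ball c s \<subseteq> interior {x \<in> cball c s. g (fst x) \<le> snd x}"
proof -
  have le10: "norm x \<le> 10" if "x \<in> cball c s" for x
    using that c norm_triangle_ineq2[of x c] by (auto simp: dist_norm norm_minus_commute)
  have fst20: "norm (fst x) < 20" if "x \<in> cball c s" for x
    using le10[OF that] norm_components_le(1)[of x] by linarith
  have cg: "continuous_on (ball 0 20) g"
    by (rule abs_diff_le_dist_imp_continuous_on[where L = L])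
       (use tangent_solutionD(1)[OF sol] in \<open>auto simp: dist_norm\<close>)
  have "continuous_on (cball c s) (\<lambda>x. g (fst x))"
    by (rule continuous_on_compose2[OF cg continuous_on_fst[OF continuous_on_id]])
       (use fst20 in auto)
  then have "continuous_on (cball c s) (\<lambda>x. snd x - g (fst x))"
    by (intro continuous_on_diff continuous_on_snd continuous_on_id)
  then have "closed (cball c s \<inter> (\<lambda>x. snd x - g (fst x)) -` {0..})"
    by (intro continuous_closed_preimage) auto
  moreover have eq: "{x \<in> cball c s. g (fst x) \<le> snd x} = cball c s \<inter> (\<lambda>x. snd x - g (fst x)) -` {0..}"
    by auto
  moreover have "bounded {x \<in> cball c s. g (fst x) \<le> snd x}"
    by (rule bounded_subset[OF bounded_cball[of c s]]) auto
  ultimately show "compact {x \<in> cball c s. g (fst x) \<le> snd x}"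
    by (simp add: compact_eq_bounded_closed)
  show "continuous_on {x \<in> cball c s. g (fst x) \<le> snd x} u"
    by (rule continuous_on_subset[OF tangent_solutionD(5)[OF sol]])
       (use le10 tangent_solution_mem(2)[OF sol] in blast)
  have "open (above_graph g \<inter> ball c s)"
    using singular_solutionD(1)[OF tangent_solutionD(4)[OF sol]] by blast
  then show "above_graph g \<inter> ball c s \<subseteq> interior {x \<in> cball c s. g (fst x) \<le> snd x}"
    by (rule interior_maximal[rotated]) (auto simp: above_graph_def)
qed

lemma ball_subset_above_graph:
  assumes sol: "tangent_solution \<gamma> L g u" and L: "L > 0"
    and y: "norm (fst y) \<le> 10" "0 < snd y - g (fst y)" "snd y - g (fst y) \<le> 9"
  shows "ball y ((snd y - g (fst y)) / (1 + L)) \<subseteq> above_graph g"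
proof
  define h where "h = snd y - g (fst y)"
  fix z assume "z \<in> ball y ((snd y - g (fst y)) / (1 + L))"
  then have "(1 + L) * norm (z - y) < h"
    using L by (simp add: h_def dist_norm norm_minus_commute field_simps)
  then have d: "norm (z - y) + L * norm (z - y) < h" by (simp add: algebra_simps)
  have L0: "0 \<le> L * norm (z - y)" using L by simp
  have f: "norm (fst z - fst y) \<le> norm (z - y)" and s: "\<bar>snd z - snd y\<bar> \<le> norm (z - y)"
    using norm_components_le(1)[of "z - y"] norm_components_le(2)[of "z - y"] by simp_all
  have fz: "norm (fst z) < 20"
    using norm_triangle_sub[of "fst z" "fst y"] f d L0 y unfolding h_def by linarith
  have "\<bar>g (fst z) - g (fst y)\<bar> \<le> L * norm (fst z - fst y)"
    using tangent_solutionD(1)[OF sol fz] y by simp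
  also have "\<dots> \<le> L * norm (z - y)" using L f by simp
  finally have "\<bar>g (fst z) - g (fst y)\<bar> \<le> L * norm (z - y)" .
  then show "z \<in> above_graph g"
    using fz s d y unfolding above_graph_def h_def mem_Collect_eq by linarith
qed

lemma ball_half_subset_above_graph:
  assumes sol: "tangent_solution \<gamma> L g u"
    and y: "norm (fst y) \<le> 10" "1 \<le> snd y" "snd y \<le> 10"
  shows "ball y (1 / 2) \<subseteq> above_graph g"
proof
  fix z assume "z \<in> ball y (1 / 2)"
  then have d: "norm (z - y) < 1 / 2" by (simp add: dist_norm norm_minus_commute)
  have f: "norm (fst z - fst y) \<le> norm (z - y)" and s: "\<bar>snd z - snd y\<bar> \<le> norm (z - y)"
    using norm_components_le(1)[of "z - y"] norm_components_le(2)[of "z - y"] by simp_all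
  have fz: "norm (fst z) < 20"
    using norm_triangle_sub[of "fst z" "fst y"] f d y by linarith
  then have "\<bar>g (fst z)\<bar> \<le> 1 / 4" by (rule tangent_solutionD(2)[OF sol])
  then show "z \<in> above_graph g"
    using fz s d y unfolding above_graph_def mem_Collect_eq by linarith
qed

lemma harnack_chain:
  fixes p q :: "'a::euclidean_space" and H r :: real
  assumes step: "\<And>p q. p \<in> S \<Longrightarrow> q \<in> S \<Longrightarrow> dist p q \<le> r \<Longrightarrow> u p \<le> H * u q"
    and S: "convex S" and H: "H \<ge> 1" and r: "r > 0" and pos: "\<And>q. q \<in> S \<Longrightarrow> 0 < u q"
    and pq: "p \<in> S" "q \<in> S" "dist p q \<le> real k * r"
  shows "u p \<le> H ^ k * u q"
  using pq
proof (induction k arbitrary: p)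
  case 0
  then show ?case by simp
next
  case (Suc k)
  show ?case
  proof (cases "dist p q \<le> r")
    case True
    have "u p \<le> H * u q" using step True Suc.prems by blast
    also have "\<dots> \<le> H * (H ^ k * u q)"
      using H pos[OF Suc.prems(2)] by (intro mult_left_mono) auto
    finally show ?thesis by (simp add: mult.assoc)
  next
    case False
    define t where "t = r / dist p q"
    have d: "r < dist p q" "0 < dist p q" using False r by linarith+
    then have t: "0 < t" "t < 1" "t * dist p q = r" using r by (simp_all add: t_def)
    define p' where "p' = p + t *\<^sub>R (q - p)"
    have p': "p' = (1 - t) *\<^sub>R p + t *\<^sub>R q" by (simp add: p'_def algebra_simps)
    have "p' \<in> S" unfolding p' using t Suc.prems by (intro convexD[OF S]) auto
    have "dist p p' = t * dist p q"
      using t by (simp add: p'_def dist_norm norm_minus_commute)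
    then have 1: "dist p p' = r" using t by simp
    have "q - p' = (1 - t) *\<^sub>R (q - p)" by (simp add: p' algebra_simps)
    then have "dist q p' = (1 - t) * dist q p"
      using t by (simp add: dist_norm)
    then have "dist p' q = (1 - t) * dist p q" by (simp only: dist_commute)
    also have "\<dots> = dist p q - r" using t by (simp add: algebra_simps)
    also have "\<dots> \<le> real k * r" using Suc.prems(3) by (simp add: algebra_simps)
    finally have 2: "u p' \<le> H ^ k * u q" by (intro Suc.IH \<open>p' \<in> S\<close> Suc.prems)
    have "u p \<le> H * u p'" using step[OF Suc.prems(1) \<open>p' \<in> S\<close>] 1 by simp
    also have "\<dots> \<le> H * (H ^ k * u q)" using 2 H by (intro mult_left_mono) auto
    finally show ?thesis by (simp add: mult.assoc)
  qed
qed

lemma solution_height_bound: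
  fixes \<gamma> L :: real
  assumes \<gamma>: "\<gamma> > 0" and L: "L > 0"
  obtains C :: real and a :: nat where "C > 0"
    "\<And>(g :: 'a::euclidean_space \<Rightarrow> real) u y. tangent_solution \<gamma> L g u \<Longrightarrow> norm (fst y) \<le> 10 \<Longrightarrow>
       0 < snd y - g (fst y) \<Longrightarrow> snd y - g (fst y) \<le> 8 \<Longrightarrow>
       u y * (snd y - g (fst y)) ^ a \<le> C * u e_n"
proof -
  obtain H \<Lambda> :: real where H: "H \<ge> 1" and \<Lambda>: "\<Lambda> \<ge> 1" and
    harnack: "\<And>U u (x::'a \<times> real) y r. singular_solution \<gamma> U u \<Longrightarrow> r > 0 \<Longrightarrow> ball x (\<Lambda> * r) \<subseteq> U \<Longrightarrow>
       dist x y \<le> r \<Longrightarrow> u x \<le> H * u y"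
    by (rule solution_harnack[OF \<gamma>, where 'a = "'a \<times> real"], rule that)
  define c where "c = 1 / ((1 + L) * \<Lambda>)"
  have LL: "(1 + L) * \<Lambda> \<ge> 1" using mult_mono[of 1 "1 + L" 1 \<Lambda>] L \<Lambda> by simp
  then have c: "0 < c" "c \<le> 1" by (auto simp: c_def)
  obtain a where a: "H < (1 + c) ^ a" using real_arch_pow[of "1 + c" H] c by auto
  obtain k0 :: nat where k0: "60 * \<Lambda> \<le> real k0" using real_arch_simple by blast
  define C where "C = H ^ k0 * 8 ^ a"
  show ?thesis
  proof
    show "C > 0" using H by (simp add: C_def)
    fix g :: "'a \<Rightarrow> real" and u y0
    assume sol: "tangent_solution \<gamma> L g u"
    note S = singular_solutionD[OF tangent_solutionD(4)[OF sol]]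
    define Z where "Z = {z::'a \<times> real. norm (fst z) \<le> 10 \<and> 1 \<le> snd z \<and> snd z \<le> 10}"
    have Z_sub: "ball z (1 / 2) \<subseteq> above_graph g" if "z \<in> Z" for z
      using that unfolding Z_def by (intro ball_half_subset_above_graph[OF sol]) auto
    have Z_mem: "z \<in> above_graph g" if "z \<in> Z" for z
      using Z_sub[OF that] centre_in_ball[of z "1 / 2"] by (simp add: subsetD)
    have Z_eq: "Z = cball 0 10 \<times> {1..10}" unfolding Z_def by auto
    have Z: "convex Z" unfolding Z_eq by (intro convex_Times) auto
    have e_n: "e_n \<in> Z" by (simp add: Z_def e_n_def)
    have pos_e: "0 < u e_n"
      by (intro S(3) Z_mem e_n)
    have base: "u y * (snd y - g (fst y)) ^ a \<le> C * u e_n"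
      if y: "norm (fst y) \<le> 10" "0 < snd y - g (fst y)" "snd y - g (fst y) \<le> 8" "1 \<le> snd y" for y
    proof -
      have "\<bar>g (fst y)\<bar> \<le> 1 / 4" using y by (intro tangent_solutionD(2)[OF sol]) simp
      with y have yZ: "y \<in> Z" by (simp add: Z_def)
      have "u y \<le> H ^ k0 * u e_n"
      proof (rule harnack_chain[OF _ Z H, where r = "1 / (2 * \<Lambda>)"])
        fix p q assume "p \<in> Z" "q \<in> Z" "dist p q \<le> 1 / (2 * \<Lambda>)"
        then show "u p \<le> H * u q"
          using harnack[OF tangent_solutionD(4)[OF sol], of "1 / (2 * \<Lambda>)" p q] Z_sub[of p] \<Lambda> by simp
      next
        fix q assume "q \<in> Z"
        then show "0 < u q" by (intro S(3) Z_mem)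
      next
        have "norm (y - e_n) \<le> norm (fst y) + norm (snd y - 1)"
          using norm_Pair_le[of "fst y" "snd y - 1"] by (cases y) (simp add: e_n_def)
        also have "\<dots> \<le> 30" using yZ by (simp add: Z_def)
        also have "30 \<le> real k0 * (1 / (2 * \<Lambda>))" using k0 \<Lambda> by (simp add: field_simps)
        finally show "dist y e_n \<le> real k0 * (1 / (2 * \<Lambda>))" by (simp add: dist_norm)
      qed (use yZ e_n \<Lambda> in auto)
      moreover have "(snd y - g (fst y)) ^ a \<le> 8 ^ a" using y by (intro power_mono) auto
      ultimately have "u y * (snd y - g (fst y)) ^ a \<le> H ^ k0 * u e_n * 8 ^ a"
        using y H pos_e by (intro mult_mono) auto
      then show ?thesis by (simp add: C_def mult_ac)
    qed
    have ind: "u y * (snd y - g (fst y)) ^ a \<le> C * u e_n"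
      if "norm (fst y) \<le> 10" "0 < snd y - g (fst y)" "snd y - g (fst y) \<le> 8"
        "5 / 4 \<le> (snd y - g (fst y)) * (1 + c) ^ k" for y k
      using that
    proof (induction k arbitrary: y)
      case 0
      have "\<bar>g (fst y)\<bar> \<le> 1 / 4" using 0 by (intro tangent_solutionD(2)[OF sol]) simp
      with 0 show ?case by (intro base) auto
    next
      case (Suc k)
      define h where "h = snd y - g (fst y)"
      have g4: "\<bar>g (fst y)\<bar> \<le> 1 / 4" using Suc by (intro tangent_solutionD(2)[OF sol]) simp
      show ?case
      proof (cases "1 \<le> snd y")
        case True
        then show ?thesis using Suc.prems by (intro base) auto
      next
        case False
        have h: "0 < h" "h \<le> 5 / 4" using False g4 Suc.prems by (auto simp: h_def)
        define y' where "y' = y + (c * h) *\<^sub>R e_n"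
        have y': "fst y' = fst y" "snd y' = snd y + c * h" by (auto simp: y'_def e_n_def)
        have h': "snd y' - g (fst y') = (1 + c) * h" by (simp add: y' h_def algebra_simps)
        have ch: "(1 + c) * h \<le> 8"
          using mult_mono[of "1 + c" 2 h "5 / 4"] c h by simp
        have "(1 + c) * h > 0" using c h by simp
        have IH: "u y' * ((1 + c) * h) ^ a \<le> C * u e_n"
          using Suc.prems ch \<open>(1 + c) * h > 0\<close>
          by (intro Suc.IH[of y', unfolded h']) (simp_all add: y' h_def mult_ac)
        have u': "0 < u y'"
        proof (rule S(3))
          have "(1 + c) * h \<le> 9" using ch by simp
          then have "ball y' ((1 + c) * h / (1 + L)) \<subseteq> above_graph g"
            using ball_subset_above_graph[OF sol L, of y', unfolded h'] Suc.prems(1) \<open>(1 + c) * h > 0\<close>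
            by (simp only: y')
          moreover have "0 < (1 + c) * h / (1 + L)" using \<open>(1 + c) * h > 0\<close> L by simp
          ultimately show "y' \<in> above_graph g" by (meson centre_in_ball subsetD)
        qed
        have "u y \<le> H * u y'"
        proof (rule harnack[OF tangent_solutionD(4)[OF sol], of "c * h"])
          have "\<Lambda> \<noteq> 0" "1 + L \<noteq> 0" using \<Lambda> L by auto
          then have "\<Lambda> * (c * h) = h / (1 + L)" unfolding c_def by simp
          then show "ball y (\<Lambda> * (c * h)) \<subseteq> above_graph g"
            using ball_subset_above_graph[OF sol L, of y] Suc.prems by (simp add: h_def)
          show "dist y y' \<le> c * h" using c h by (simp add: y'_def dist_norm e_n_def)
        qed (use c h in simp)
        also have "\<dots> \<le> (1 + c) ^ a * u y'" using a u' by (intro mult_right_mono) auto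
        finally have "u y * h ^ a \<le> (1 + c) ^ a * u y' * h ^ a"
          using h by (intro mult_right_mono) auto
        also have "\<dots> = u y' * ((1 + c) * h) ^ a" by (simp add: power_mult_distrib mult_ac)
        finally show ?thesis using IH by (simp add: h_def)
      qed
    qed
    assume y: "norm (fst y0) \<le> 10" "0 < snd y0 - g (fst y0)" "snd y0 - g (fst y0) \<le> 8"
    obtain k where "5 / 4 / (snd y0 - g (fst y0)) < (1 + c) ^ k"
      using real_arch_pow[of "1 + c" "5 / 4 / (snd y0 - g (fst y0))"] c by auto
    then have "5 / 4 \<le> (snd y0 - g (fst y0)) * (1 + c) ^ k"
      using y by (simp add: field_simps)
    then show "u y0 * (snd y0 - g (fst y0)) ^ a \<le> C * u e_n" by (rule ind[OF y])
  qed
qed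

lemma has_real_derivative_powr_minus:
  fixes a n :: real
  assumes "a > 0"
  shows "((\<lambda>a. a powr (- n)) has_real_derivative - n * a powr (- n - 1)) (at a)"
  using has_real_derivative_powr[of a "- n"] assms by simp

lemma has_real_derivative_powr_minus_one:
  fixes a n :: real
  assumes "a > 0"
  shows "((\<lambda>a. a powr (- n - 1)) has_real_derivative (- n - 1) * a powr (- n - 2)) (at a)"
proof -
  have "- n - 1 - 1 = - n - 2" by simp
  with has_real_derivative_powr[OF assms, of "- n - 1"] show ?thesis by (simp only:)
qed

lemma mult_powr_minus_two:
  fixes a n :: real
  assumes "a > 0"
  shows "a * a powr (- n - 2) = a powr (- n - 1)"
proof -
  have "a powr 1 * a powr (- n - 2) = a powr (1 + (- n - 2))" by (simp only: powr_add)
  moreover have "1 + (- n - 2) = - n - 1" by simp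
  ultimately show ?thesis using assms by simp
qed

text \<open>The barrier lives outside the ball of radius \<open>h\<close> about \<open>p\<close>, which lies below the graph by the Lipschitz
  bound; the summand \<open>(400 - |x - p|\<^sup>2) / (2 n)\<close> absorbs the right-hand side where \<open>u > 1\<close>.\<close>

lemma boundary_decay:
  fixes u :: "'a::euclidean_space \<times> real \<Rightarrow> real"
  defines "n \<equiv> real DIM('a \<times> real)"
  assumes sol: "tangent_solution \<gamma> L g u" and \<gamma>: "\<gamma> > 0" and L: "L > 0"
    and h: "h = snd y0 - g (fst y0)" "0 < h" and s: "norm y0 + s \<le> 10"
    and e: "0 < e" "e < 1" "h * (2 + L + 1 / e) \<le> s"
    and M: "0 \<le> M" "\<And>x. x \<in> cball y0 s \<Longrightarrow> g (fst x) \<le> snd x \<Longrightarrow> u x \<le> M"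
  shows "u y0 \<le> M / (1 - e) * (1 - ((2 + L)\<^sup>2) powr (- n)) + 201"
proof -
  note S = singular_solutionD[OF tangent_solutionD(4)[OF sol]]
  have n: "n \<ge> 1" by (simp add: n_def)
  define p where "p = (fst y0, g (fst y0) - (1 + L) * h)"
  define N where "N = M / (1 - e)"
  have N: "0 \<le> N" using M e by (simp add: N_def)
  define D where "D = {x \<in> cball y0 s. g (fst x) \<le> snd x}"
  define F where "F a = N * (1 - h\<^sup>2 powr n * a powr (- n)) + 1 + (400 - a) / (2 * n)" for a
  define F1 where "F1 a = N * (h\<^sup>2 powr n * (n * a powr (- n - 1))) - 1 / (2 * n)" for a
  define F2 where "F2 a = N * (h\<^sup>2 powr n * (n * ((- n - 1) * a powr (- n - 2))))" for a
  have hs: "h * (2 + L) + h / e \<le> s" using e(3) by (simp add: algebra_simps)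
  have he: "h \<le> h / e" using h(2) e by (simp add: field_simps)
  have hL: "0 < h * L" using h L by simp
  have s0: "0 < s" using hs h(2) he hL by (simp add: algebra_simps)
  have py: "norm (y0 - p) = (2 + L) * h"
  proof -
    have "y0 - p = (0, (2 + L) * h)"
      by (rule prod_eqI) (simp_all add: p_def h(1) algebra_simps)
    then show ?thesis using h L by (simp add: norm_Pair)
  qed
  have fst20: "norm (fst x) < 20" if "x \<in> cball y0 s" for x
    using that s norm_components_le(1)[of x] norm_triangle_ineq2[of x y0]
    by (simp add: dist_norm norm_minus_commute)
  have far: "h \<le> norm (x - p)" if x: "x \<in> D" for x
  proof (rule ccontr)
    assume "\<not> h \<le> norm (x - p)"
    then have lt: "norm (x - p) < h" by simp
    have c: "norm (fst x - fst y0) \<le> norm (x - p)" "\<bar>snd x - snd p\<bar> \<le> norm (x - p)"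
      using norm_components_le[of "x - p"] by (simp_all add: p_def)
    have "\<bar>g (fst x) - g (fst y0)\<bar> \<le> L * norm (fst x - fst y0)"
      using fst20[of x] fst20[of y0] x s0 by (intro tangent_solutionD(1)[OF sol]) (auto simp: D_def)
    also have "\<dots> \<le> L * h" using c(1) lt L by (intro mult_left_mono) auto
    finally have "snd x < g (fst x)"
      using c(2) lt unfolding p_def by (simp add: algebra_simps)
    then show False using x by (simp add: D_def)
  qed
  have near: "norm (x - p) \<le> 20" if "x \<in> D" for x
  proof -
    have "norm (x - p) \<le> norm (x - y0) + norm (y0 - p)"
      using norm_triangle_ineq[of "x - y0" "y0 - p"] by simp
    also have "\<dots> \<le> s + s"
      using that hs he h(2) e py by (intro add_mono) (auto simp: D_def dist_norm norm_minus_commute algebra_simps)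
    finally show ?thesis using s norm_ge_zero[of y0] by linarith
  qed
  have a_ge: "h\<^sup>2 \<le> (norm (x - p))\<^sup>2" and a_le: "(norm (x - p))\<^sup>2 \<le> 400" if "x \<in> D" for x
    using power_mono[OF far[OF that], of 2] power_mono[OF near[OF that], of 2] h by auto
  have h2: "0 < h\<^sup>2" using h by simp
  have quot: "h\<^sup>2 powr n * a powr (- n) = (h\<^sup>2 / a) powr n" if "h\<^sup>2 \<le> a" for a
    using that h2 by (simp add: powr_divide powr_minus field_simps)
  have F_ge1: "1 \<le> F a" if "h\<^sup>2 \<le> a" "a \<le> 400" for a
  proof -
    have "0 < a" using that h2 by linarith
    then have "(h\<^sup>2 / a) powr n \<le> 1" using that n by (intro powr_le1) auto
    then have "0 \<le> N * (1 - h\<^sup>2 powr n * a powr (- n))"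
      unfolding quot[OF that(1)] using N by simp
    moreover have "0 \<le> (400 - a) / (2 * n)" using that n by simp
    ultimately show ?thesis unfolding F_def by linarith
  qed
  note comp = tangent_solution_compact[OF sol s, folded D_def]
  have y0D: "y0 \<in> D" using h s0 by (simp add: D_def)
  have "1 * u y0 \<le> 1 * F ((norm (y0 - p))\<^sup>2)"
  proof (rule radial_comparison[OF S(1,2) comp(1,2), where F = F and p = p and T = "{0<..}" and ?F1.0 = F1 and ?F2.0 = F2])
    have "(norm (x - p))\<^sup>2 \<noteq> 0" if "x \<in> D" for x using a_ge[OF that] h2 by linarith
    then show "continuous_on D (\<lambda>x. F ((norm (x - p))\<^sup>2))"
      unfolding F_def by (intro continuous_intros) (use n in auto)
    show "(F has_real_derivative F1 a) (at a)" if "a \<in> {0<..}" for a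
      unfolding F_def[abs_def] F1_def using that n
      by (auto intro!: derivative_eq_intros has_real_derivative_powr_minus simp: field_simps)
    show "(F1 has_real_derivative F2 a) (at a)" if "a \<in> {0<..}" for a
    proof -
      have "((\<lambda>a. a powr (- n - 1)) has_real_derivative (- n - 1) * a powr (- n - 2)) (at a)"
        using that by (intro has_real_derivative_powr_minus_one) simp
      from DERIV_cmult[OF DERIV_cmult[OF DERIV_cmult[OF this]]]
      have "((\<lambda>a. N * (h\<^sup>2 powr n * (n * a powr (- n - 1))) - 1 / (2 * n)) has_real_derivative F2 a - 0) (at a)"
        unfolding F2_def by (intro DERIV_diff DERIV_const)
      then show ?thesis by (simp add: F1_def[abs_def])
    qed
    fix x assume xD: "x \<in> D" and "1 * F ((norm (x - p))\<^sup>2) < 1 * u x"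
    define \<alpha> where "\<alpha> = (norm (x - p))\<^sup>2"
    have less: "F \<alpha> < u x" using \<open>1 * F _ < 1 * u x\<close> by (simp add: \<alpha>_def)
    have \<alpha>: "h\<^sup>2 \<le> \<alpha>" "\<alpha> \<le> 400" "0 < \<alpha>" using a_ge[OF xD] a_le[OF xD] h2 by (auto simp: \<alpha>_def)
    have ux: "1 < u x" using F_ge1[OF \<alpha>(1,2)] less by simp
    have x10: "norm x \<le> 10"
      using xD s norm_triangle_ineq2[of x y0] by (simp add: D_def dist_norm norm_minus_commute)
    have xG: "x \<in> above_graph g"
      using tangent_solution_mem(1)[OF sol x10] xD ux by (auto simp: D_def)
    have "dist y0 x \<noteq> s"
    proof
      assume eq: "dist y0 x = s"
      have "h / e \<le> norm (x - y0) - norm (y0 - p)"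
        using hs eq py by (simp add: dist_norm norm_minus_commute algebra_simps)
      also have "\<dots> \<le> norm (x - p)"
        using norm_triangle_ineq[of "x - p" "p - y0"] by (simp add: norm_minus_commute)
      finally have "(h / e)\<^sup>2 \<le> \<alpha>" unfolding \<alpha>_def using h e by (intro power_mono) auto
      then have "h\<^sup>2 / \<alpha> \<le> e\<^sup>2" using \<alpha> e by (simp add: field_simps power_divide)
      also have "e\<^sup>2 \<le> e" using e by (simp add: power2_eq_square)
      finally have q: "h\<^sup>2 / \<alpha> \<le> e" .
      have "(h\<^sup>2 / \<alpha>) powr n \<le> (h\<^sup>2 / \<alpha>) powr 1"
        using n q e zero_le_divide_iff[of "h\<^sup>2" \<alpha>] \<alpha>(1,3) by (intro powr_mono') simp_all
      also have "\<dots> = h\<^sup>2 / \<alpha>" using \<alpha> by simp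
      finally have "N * (1 - e) \<le> N * (1 - h\<^sup>2 powr n * \<alpha> powr (- n))"
        unfolding quot[OF \<alpha>(1)] using q N by (intro mult_left_mono) auto
      moreover have "N * (1 - e) = M" using e by (simp add: N_def)
      moreover have "0 \<le> (400 - \<alpha>) / (2 * n)" using \<alpha> n by simp
      ultimately have "M < F \<alpha>" unfolding F_def by linarith
      with M(2)[of x] xD less show False by (simp add: D_def)
    qed
    then have "x \<in> above_graph g \<inter> ball y0 s" using xG xD by (simp add: D_def)
    moreover have "4 * \<alpha> * F2 \<alpha> + 2 * n * F1 \<alpha> \<le> -1"
    proof -
      have eq: "\<alpha> powr (- n - 1) = \<alpha> * \<alpha> powr (- n - 2)"
        by (rule mult_powr_minus_two[OF \<alpha>(3), symmetric])
      have "4 * \<alpha> * F2 \<alpha> + 2 * n * F1 \<alpha> =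
          - (N * h\<^sup>2 powr n * \<alpha> powr (- n - 1) * (2 * n * (n + 2))) - 1"
        unfolding F1_def F2_def eq using n
        by (simp add: algebra_simps)
      moreover have "0 \<le> N * h\<^sup>2 powr n * \<alpha> powr (- n - 1) * (2 * n * (n + 2))"
        using N n by (intro mult_nonneg_nonneg) auto
      ultimately show ?thesis by linarith
    qed
    moreover have "- 1 < laplacian u x"
      using S(4)[OF xG] ux \<gamma> powr_less_mono2_neg[of "- \<gamma>" 1 "u x"] by simp
    ultimately show "x \<in> above_graph g \<and> x \<in> interior D \<and> (norm (x - p))\<^sup>2 \<in> {0<..} \<and>
       1 * (4 * (norm (x - p))\<^sup>2 * F2 ((norm (x - p))\<^sup>2) + 2 * DIM('a \<times> real) * F1 ((norm (x - p))\<^sup>2))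
         < 1 * laplacian u x"
      using xG comp(3) \<alpha>(3) unfolding \<alpha>_def[symmetric] n_def by auto
  qed (use y0D in auto)
  moreover have "F ((norm (y0 - p))\<^sup>2) \<le> N * (1 - ((2 + L)\<^sup>2) powr (- n)) + 201"
  proof -
    have "(norm (y0 - p))\<^sup>2 = (2 + L)\<^sup>2 * h\<^sup>2" by (simp add: py power_mult_distrib)
    then have eq: "h\<^sup>2 powr n * ((norm (y0 - p))\<^sup>2) powr (- n) = ((2 + L)\<^sup>2) powr (- n)"
      using h2 L by (simp add: powr_mult powr_minus)
    have "(400 - (norm (y0 - p))\<^sup>2) / (2 * n) \<le> 400 / 2"
      using n by (intro frac_le) auto
    then show ?thesis unfolding F_def eq by linarith
  qed
  ultimately show ?thesis by (simp add: N_def)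
qed

lemma tangent_solution_e_n_ge:
  fixes u :: "'a::euclidean_space \<times> real \<Rightarrow> real"
  assumes sol: "tangent_solution \<gamma> L g u" and \<gamma>: "\<gamma> > 0"
  shows "ball_const TYPE('a \<times> real) \<gamma> * (1 / 4) powr (2 / (1 + \<gamma>)) \<le> u e_n"
proof (rule solution_ge_dist_powr[OF tangent_solutionD(4)[OF sol] \<gamma> refl])
  have "ball e_n (1 / 2) \<subseteq> above_graph g"
    by (rule ball_half_subset_above_graph[OF sol]) (auto simp: e_n_def)
  then show "cball e_n (1 / 4) \<subseteq> above_graph g" by force
qed simp

text \<open>Maximise \<open>u (y) (5 - |y|)\<^sup>a\<close>. Far from the graph, relative to \<open>5 - |y|\<close>, the maximum is
  controlled by the Harnack chain; near it, the maximum nearly dominates \<open>u\<close> on a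
  neighbourhood, and the decay at the boundary bounds it by an absolute constant.\<close>

lemma carleson_estimate:
  fixes \<gamma> L :: real
  assumes \<gamma>: "\<gamma> > 0" and L: "L > 0"
  obtains C :: real where "C > 0"
    "\<And>(g :: 'a::euclidean_space \<Rightarrow> real) u y. tangent_solution \<gamma> L g u \<Longrightarrow> norm y \<le> 3 \<Longrightarrow>
       g (fst y) \<le> snd y \<Longrightarrow> u y \<le> C * u e_n"
proof -
  obtain C1 :: real and a :: nat where C1: "C1 > 0" and
    height: "\<And>(g :: 'a \<Rightarrow> real) u y. tangent_solution \<gamma> L g u \<Longrightarrow> norm (fst y) \<le> 10 \<Longrightarrow>
       0 < snd y - g (fst y) \<Longrightarrow> snd y - g (fst y) \<le> 8 \<Longrightarrow>
       u y * (snd y - g (fst y)) ^ a \<le> C1 * u e_n"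
    by (rule solution_height_bound[OF \<gamma> L, where 'a = 'a], rule that)
  define \<eta> where "\<eta> = ((2 + L)\<^sup>2) powr (- real DIM('a \<times> real))"
  have "1 \<le> (2 + L)\<^sup>2" using L by (simp add: one_le_power)
  then have \<eta>: "0 < \<eta>" "\<eta> \<le> 1"
    using L powr_mono2'[of "- real DIM('a \<times> real)" 1 "(2 + L)\<^sup>2"] by (simp_all add: \<eta>_def)
  define e where "e = \<eta> / 4"
  define \<tau> where "\<tau> = \<eta> / (4 * (real a + 1))"
  have e: "0 < e" "e < 1" using \<eta> by (auto simp: e_def)
  have at: "real a * \<tau> \<le> \<eta> / 4" "\<tau> \<le> \<eta> / 4" "0 < \<tau>"
    using \<eta> by (auto simp: \<tau>_def field_simps)
  have \<tau>: "0 < \<tau>" "\<tau> < 1" using at \<eta> by auto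
  have \<tau>a: "1 - \<eta> / 2 \<le> (1 - \<tau>) ^ a * (1 - e)"
  proof -
    have "1 + real a * (- \<tau>) \<le> (1 + (- \<tau>)) ^ a"
      using \<tau> by (intro Bernoulli_inequality) auto
    then have "1 - \<eta> / 4 \<le> (1 - \<tau>) ^ a" using at by simp
    then have "(1 - \<eta> / 4) * (1 - e) \<le> (1 - \<tau>) ^ a * (1 - e)"
      using e by (intro mult_right_mono) auto
    moreover have "1 - \<eta> / 2 \<le> (1 - \<eta> / 4) * (1 - e)"
      by (simp add: e_def algebra_simps)
    ultimately show ?thesis by linarith
  qed
  define \<epsilon> where "\<epsilon> = \<tau> / (2 + L + 1 / e)"
  have den: "0 < 2 + L + 1 / e" using L e by (intro add_pos_pos) auto
  then have \<epsilon>: "0 < \<epsilon>" using \<tau> by (simp add: \<epsilon>_def)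
  define c where "c = ball_const TYPE('a \<times> real) \<gamma> * (1 / 4) powr (2 / (1 + \<gamma>))"
  have c: "0 < c" by (simp add: c_def ball_const_pos)
  define C where "C = C1 / \<epsilon> ^ a + 5 ^ a * (402 / \<eta>) / c"
  show ?thesis
  proof
    show "C > 0" using C1 \<epsilon> \<eta> c by (auto simp: C_def intro!: add_pos_pos)
    fix g :: "'a \<Rightarrow> real" and u y
    assume sol: "tangent_solution \<gamma> L g u" and y: "norm y \<le> 3" "g (fst y) \<le> snd y"
    note S = singular_solutionD[OF tangent_solutionD(4)[OF sol]]
    have ue: "c \<le> u e_n" unfolding c_def by (rule tangent_solution_e_n_ge[OF sol \<gamma>])
    have nonneg: "0 \<le> u x" if "norm x \<le> 5" "g (fst x) \<le> snd x" for x
      using tangent_solution_mem(1)[OF sol _ that(2)] that(1) S(3)[of x] by force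
    define D where "D = {x \<in> cball 0 5. g (fst x) \<le> snd x}"
    define W where "W x = u x * (5 - norm x) ^ a" for x
    have "norm (0 :: 'a \<times> real) + 5 \<le> 10" by simp
    note comp = tangent_solution_compact[OF sol this, folded D_def]
    have "continuous_on D W" unfolding W_def by (intro continuous_intros comp)
    moreover have yD: "y \<in> D" using y by (simp add: D_def)
    ultimately obtain y0 where y0: "y0 \<in> D" and "\<forall>x\<in>D. W x \<le> W y0"
      using continuous_attains_sup[OF comp(1)] by blast
    then have max: "W x \<le> W y0" if "x \<in> D" for x using that by blast
    define \<rho> where "\<rho> = 5 - norm y0"
    have \<rho>: "0 \<le> \<rho>" "\<rho> \<le> 5" using y0 by (auto simp: \<rho>_def D_def)
    have nn: "0 \<le> u y0" using y0 by (intro nonneg) (auto simp: D_def)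
    have "W y0 \<le> C * u e_n"
    proof (cases "u y0 = 0 \<or> \<rho> = 0 \<and> a > 0")
      case True
      then have "W y0 = 0" by (auto simp: W_def \<rho>_def)
      then show ?thesis using \<open>C > 0\<close> ue c by simp
    next
      case False
      define h where "h = snd y0 - g (fst y0)"
      have y0n: "norm y0 \<le> 5" "g (fst y0) \<le> snd y0" using y0 by (auto simp: D_def)
      have y0G: "y0 \<in> above_graph g"
        using tangent_solution_mem(1)[OF sol _ y0n(2)] y0n(1) False by auto
      have comps: "norm (fst y0) \<le> 5" "\<bar>snd y0\<bar> \<le> 5" using norm_components_le[of y0] y0n by linarith+
      have "\<bar>g (fst y0)\<bar> \<le> 1 / 4" using comps by (intro tangent_solutionD(2)[OF sol]) simp
      then have h: "0 < h" "h \<le> 8" using comps y0G by (auto simp: h_def above_graph_def)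
      have W0: "W y0 = u y0 * \<rho> ^ a" by (simp add: W_def \<rho>_def)
      show ?thesis
      proof (cases "\<epsilon> * \<rho> \<le> h")
        case True
        then have "\<rho> \<le> h / \<epsilon>" using \<epsilon> by (simp add: field_simps)
        then have "W y0 \<le> u y0 * (h / \<epsilon>) ^ a"
          unfolding W0 using nn \<rho> by (intro mult_left_mono power_mono) auto
        also have "\<dots> = u y0 * h ^ a / \<epsilon> ^ a" by (simp add: power_divide)
        also have "\<dots> \<le> C1 * u e_n / \<epsilon> ^ a"
          using height[OF sol, of y0] comps h \<epsilon> by (intro divide_right_mono) (auto simp: h_def)
        also have "\<dots> \<le> C * u e_n"
          using ue c \<eta> by (simp add: C_def algebra_simps)
        finally show ?thesis .
      next
        case close: False
        have \<rho>0: "0 < \<rho>" using close h \<epsilon> \<rho> by (cases "\<rho> = 0") auto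
        define M where "M = u y0 / (1 - \<tau>) ^ a"
        have t0: "0 < (1 - \<tau>) ^ a" using \<tau> by simp
        have "u y0 \<le> M / (1 - e) * (1 - ((2 + L)\<^sup>2) powr (- real DIM('a \<times> real))) + 201"
        proof (rule boundary_decay[OF sol \<gamma> L h_def h(1) _ e])
          have "\<tau> * \<rho> \<le> \<rho>" using \<tau> \<rho> by (simp add: mult_left_le_one_le)
          then have r5: "norm y0 + \<tau> * \<rho> \<le> 5" by (simp add: \<rho>_def)
          then show "norm y0 + \<tau> * \<rho> \<le> 10" by simp
          have "h * (2 + L + 1 / e) \<le> \<epsilon> * \<rho> * (2 + L + 1 / e)"
            using close den by (intro mult_right_mono) auto
          also have "\<dots> = \<tau> * \<rho>" using den by (simp add: \<epsilon>_def)
          finally show "h * (2 + L + 1 / e) \<le> \<tau> * \<rho>" .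
          show "0 \<le> M" using nn t0 by (simp add: M_def)
          fix x assume x: "x \<in> cball y0 (\<tau> * \<rho>)" "g (fst x) \<le> snd x"
          have "norm x \<le> norm y0 + \<tau> * \<rho>"
            using x norm_triangle_ineq2[of x y0] by (simp add: dist_norm norm_minus_commute)
          then have xn: "norm x \<le> 5" "(1 - \<tau>) * \<rho> \<le> 5 - norm x"
            using r5 by (auto simp: \<rho>_def algebra_simps)
          have "u x * ((1 - \<tau>) * \<rho>) ^ a \<le> W x"
            unfolding W_def using xn \<tau> \<rho> x nonneg by (intro mult_left_mono power_mono) auto
          also have "\<dots> \<le> u y0 * \<rho> ^ a" using max[of x] x xn by (simp add: D_def W0)
          finally have "u x * (1 - \<tau>) ^ a * \<rho> ^ a \<le> u y0 * \<rho> ^ a"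
            by (simp add: power_mult_distrib mult.assoc)
          then have "u x * (1 - \<tau>) ^ a \<le> u y0" using \<rho>0 by simp
          then show "u x \<le> M" using t0 by (simp add: M_def field_simps)
        qed
        also have "M / (1 - e) * (1 - ((2 + L)\<^sup>2) powr (- real DIM('a \<times> real))) \<le> (1 - \<eta> / 2) * u y0"
        proof -
          have "(1 - \<eta>) * u y0 \<le> (1 - \<eta> / 2) * (1 - \<eta> / 2) * u y0"
            using nn by (intro mult_right_mono) (auto simp: algebra_simps)
          also have "\<dots> \<le> (1 - \<eta> / 2) * u y0 * ((1 - \<tau>) ^ a * (1 - e))"
            using mult_left_mono[OF \<tau>a, of "(1 - \<eta> / 2) * u y0"] nn \<eta> by (simp add: mult_ac)
          finally show ?thesis
            unfolding M_def \<eta>_def[symmetric] using t0 e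
            by (simp add: pos_divide_le_eq mult_ac)
        qed
        finally have "u y0 * \<eta> \<le> 402" by (simp add: algebra_simps)
        then have "u y0 \<le> 402 / \<eta>" using \<eta> by (simp add: field_simps)
        moreover have "\<rho> ^ a \<le> 5 ^ a" using \<rho> by (intro power_mono) auto
        ultimately have "W y0 \<le> 402 / \<eta> * 5 ^ a"
          unfolding W0 using \<rho> \<eta> by (intro mult_mono) auto
        also have "\<dots> = 5 ^ a * (402 / \<eta>) / c * c" using c by simp
        also have "\<dots> \<le> 5 ^ a * (402 / \<eta>) / c * u e_n"
          using ue c \<eta> by (intro mult_left_mono) auto
        also have "\<dots> \<le> C * u e_n"
          using ue c \<epsilon> C1 by (intro mult_right_mono) (auto simp: C_def)
        finally show ?thesis .
      qed
    qed
    moreover have "u y * 1 \<le> W y"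
      unfolding W_def using y nonneg by (intro mult_left_mono one_le_power) auto
    ultimately show "u y \<le> C * u e_n" using max[OF yD] by simp
  qed
qed

section \<open>Bounds on the axis\<close>

lemma norm_prod_power2:
  fixes y :: "'a::real_normed_vector \<times> real"
  shows "(norm y)\<^sup>2 = (norm (fst y))\<^sup>2 + (snd y)\<^sup>2"
  by (cases y) (simp add: norm_Pair)

lemma exterior_ball:
  assumes sol: "tangent_solution \<gamma> L g u"
  shows "g (fst x) \<le> snd x \<Longrightarrow> 1 \<le> (norm (x - - e_n))\<^sup>2"
    and "g (fst x) < snd x \<Longrightarrow> 1 < (norm (x - - e_n))\<^sup>2"
proof -
  have eq: "(norm (x - - e_n))\<^sup>2 = (norm (fst x))\<^sup>2 + (snd x + 1)\<^sup>2"
    by (simp add: norm_prod_power2 e_n_def)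
  have *: "1 - (norm (fst x))\<^sup>2 \<le> (g (fst x) + 1)\<^sup>2 \<and> 0 \<le> g (fst x) + 1" if "norm (fst x) \<le> 1"
  proof -
    have n1: "(norm (fst x))\<^sup>2 \<le> 1" using that by (simp add: power_le_one)
    have a: "sqrt (1 - (norm (fst x))\<^sup>2) \<le> g (fst x) + 1"
      using tangent_solutionD(3)[OF sol that] by linarith
    have b: "0 \<le> sqrt (1 - (norm (fst x))\<^sup>2)" using n1 by simp
    have "(sqrt (1 - (norm (fst x))\<^sup>2))\<^sup>2 \<le> (g (fst x) + 1)\<^sup>2"
      by (rule power_mono[OF a b])
    moreover have "0 \<le> g (fst x) + 1" using a b by linarith
    ultimately show ?thesis using n1 by simp
  qed
  have far: "1 < (norm (fst x))\<^sup>2" if "\<not> norm (fst x) \<le> 1"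
    using that by (simp add: one_less_power)
  show "1 \<le> (norm (x - - e_n))\<^sup>2" if "g (fst x) \<le> snd x"
  proof (cases "norm (fst x) \<le> 1")
    case True
    then have "(g (fst x) + 1)\<^sup>2 \<le> (snd x + 1)\<^sup>2" using * that by (intro power_mono) auto
    then show ?thesis using *[OF True] unfolding eq by linarith
  next
    case False
    then show ?thesis using far[OF False] zero_le_power2[of "snd x + 1"] unfolding eq by linarith
  qed
  show "1 < (norm (x - - e_n))\<^sup>2" if "g (fst x) < snd x"
  proof (cases "norm (fst x) \<le> 1")
    case True
    then have "(g (fst x) + 1)\<^sup>2 < (snd x + 1)\<^sup>2" using * that by (intro power_strict_mono) auto
    then show ?thesis using *[OF True] unfolding eq by linarith
  next
    case False
    then show ?thesis using far[OF False] zero_le_power2[of "snd x + 1"] unfolding eq by linarith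
  qed
qed

lemma interior_ball:
  assumes sol: "tangent_solution \<gamma> L g u" and \<rho>: "0 \<le> \<rho>" "\<rho> < 1"
  shows "cball e_n \<rho> \<subseteq> above_graph g"
proof
  fix z :: "'a \<times> real" assume "z \<in> cball e_n \<rho>"
  then have n: "norm (z - e_n) < 1" using \<rho> by (simp add: dist_norm norm_minus_commute)
  then have "(norm (z - e_n))\<^sup>2 < 1" by (simp add: power_less_one_iff abs_square_less_1)
  then have lt: "(norm (fst z))\<^sup>2 + (snd z - 1)\<^sup>2 < 1" by (simp add: norm_prod_power2 e_n_def)
  then have f2: "(norm (fst z))\<^sup>2 < 1" using zero_le_power2[of "snd z - 1"] by linarith
  then have f: "norm (fst z) \<le> 1" by (simp add: power2_le_imp_le)
  have "\<bar>g (fst z)\<bar> \<le> 1 - sqrt (1 - (norm (fst z))\<^sup>2)" by (rule tangent_solutionD(3)[OF sol f])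
  moreover have "\<bar>snd z - 1\<bar> < sqrt (1 - (norm (fst z))\<^sup>2)"
    using lt by (intro real_less_rsqrt) simp
  moreover have "sqrt (1 - (norm (fst z))\<^sup>2) \<le> 1" by simp
  moreover have "0 \<le> sqrt (1 - (norm (fst z))\<^sup>2)" using f2 by simp
  ultimately show "z \<in> above_graph g"
    using f unfolding above_graph_def mem_Collect_eq by linarith
qed

text \<open>The barrier is \<open>A s\<^sup>\<phi> + B s\<close> with \<open>s = 1 - |x + e\<^sub>n|\<^sup>-\<^sup>2\<^sup>n\<close>, where \<open>s\<close> is superharmonic and vanishes on the
  exterior unit sphere.\<close>

lemma tangent_solution_upper_bound:
  fixes \<gamma> L :: real
  assumes \<gamma>: "\<gamma> > 1" and L: "L > 0" and \<phi>: "\<phi> = 2 / (1 + \<gamma>)"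
  obtains C :: real where "C > 0"
    "\<And>(g :: 'a::euclidean_space \<Rightarrow> real) u t. tangent_solution \<gamma> L g u \<Longrightarrow> 0 < t \<Longrightarrow> t \<le> 1 \<Longrightarrow>
       u (t *\<^sub>R e_n) \<le> C * (t powr \<phi> + u e_n * t)"
proof -
  have \<gamma>0: "\<gamma> > 0" using \<gamma> by simp
  have \<phi>b: "0 < \<phi>" "\<phi> < 1" using \<gamma> by (auto simp: \<phi>)
  obtain C3 :: real where C3: "C3 > 0" and
    carleson: "\<And>(g :: 'a \<Rightarrow> real) u y. tangent_solution \<gamma> L g u \<Longrightarrow> norm y \<le> 3 \<Longrightarrow>
       g (fst y) \<le> snd y \<Longrightarrow> u y \<le> C3 * u e_n"
    by (rule carleson_estimate[OF \<gamma>0 L, where 'a = 'a], rule that)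
  define n where "n = real DIM('a \<times> real)"
  have n: "n \<ge> 1" by (simp add: n_def)
  define c1 where "c1 = 4 * \<phi> * (1 - \<phi>) * n\<^sup>2 * 4 powr (- 2 * n - 1)"
  have c1: "c1 > 0" using \<phi>b n by (simp add: c1_def)
  define A where "A = c1 powr (- (1 / (1 + \<gamma>)))"
  have A: "A > 0" using c1 by (simp add: A_def)
  have Ac: "A * c1 = A powr (- \<gamma>)"
  proof -
    have "A powr (1 + \<gamma>) = c1 powr - 1" using \<gamma> by (simp add: A_def powr_powr)
    also have "\<dots> = 1 / c1" using c1 by (simp add: powr_minus_divide)
    finally have "A * A powr \<gamma> = 1 / c1" using A by (simp add: powr_add)
    then show ?thesis using A c1 by (simp add: powr_minus field_simps)
  qed
  define C where "C = A * (2 * n) powr \<phi> + 4 * n * C3"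
  show ?thesis
  proof
    show "C > 0" using A C3 n by (auto simp: C_def intro!: add_nonneg_pos)
    fix g :: "'a \<Rightarrow> real" and u and t :: real
    assume sol: "tangent_solution \<gamma> L g u" and t: "0 < t" "t \<le> 1"
    note S = singular_solutionD[OF tangent_solutionD(4)[OF sol]]
    define B where "B = 2 * C3 * u e_n"
    have e_n: "0 < u e_n"
      using interior_ball[OF sol, of 0] by (intro S(3)) auto
    have B: "B > 0" using C3 e_n by (simp add: B_def)
    define s where "s a = 1 - a powr (- n)" for a :: real
    define s1 where "s1 a = n * a powr (- n - 1)" for a :: real
    define s2 where "s2 a = n * ((- n - 1) * a powr (- n - 2))" for a :: real
    define F where "F a = A * s a powr \<phi> + B * s a" for a
    define F1 where "F1 a = (A * (\<phi> * s a powr (\<phi> - 1)) + B) * s1 a" for a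
    define F2 where "F2 a = A * (\<phi> * ((\<phi> - 1) * s a powr (\<phi> - 2) * s1 a)) * s1 a
       + s2 a * (A * (\<phi> * s a powr (\<phi> - 1)) + B)" for a
    have s_nonneg: "0 \<le> s a" if "1 \<le> a" for a
      using that n powr_mono2'[of "- n" 1 a] by (simp add: s_def)
    have s_pos: "0 < s a" if "1 < a" for a
      using that n powr_less_mono2_neg[of "- n" 1 a] by (simp add: s_def)
    have F_nonneg: "0 \<le> F a" if "1 \<le> a" for a
      using s_nonneg[OF that] A B by (simp add: F_def)
    have s_der: "(s has_real_derivative s1 a) (at a)" if "1 < a" for a
      unfolding s_def[abs_def] s1_def
      by (rule DERIV_cong[OF DERIV_diff[OF DERIV_const has_real_derivative_powr_minus]]) (use that in auto)
    have s1_der: "(s1 has_real_derivative s2 a) (at a)" if "1 < a" for a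
    proof -
      have "((\<lambda>a. a powr (- n - 1)) has_real_derivative (- n - 1) * a powr (- n - 2)) (at a)"
        using that by (intro has_real_derivative_powr_minus_one) simp
      from DERIV_cmult[OF this] show ?thesis unfolding s1_def[abs_def] s2_def .
    qed
    have sp_der: "((\<lambda>a. s a powr r) has_real_derivative r * s a powr (r - 1) * s1 a) (at a)"
      if "1 < a" for a r
      by (rule DERIV_chain2[OF has_real_derivative_powr[OF s_pos[OF that]] s_der[OF that]])
    define D where "D = {x \<in> cball (- e_n) 2. g (fst x) \<le> snd x}"
    have "norm (- e_n :: 'a \<times> real) + 2 \<le> 10" by (simp add: e_n_def)
    note comp = tangent_solution_compact[OF sol this, folded D_def]
    have D_norm: "norm x \<le> 3" if "x \<in> D" for x
    proof -
      have "norm x \<le> norm (x + e_n) + norm (e_n :: 'a \<times> real)"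
        using norm_triangle_ineq4[of "x + e_n" e_n] by simp
      moreover have "norm (x + e_n) \<le> 2"
        using that norm_minus_commute[of "- e_n" x] by (simp add: D_def dist_norm)
      ultimately show ?thesis by (simp add: e_n_def)
    qed
    have D_ge: "1 \<le> (norm (x - - e_n))\<^sup>2" if "x \<in> D" for x
      using that by (intro exterior_ball(1)[OF sol]) (simp add: D_def)
    have g0: "g 0 = 0" using tangent_solutionD(3)[OF sol, of 0] by simp
    have teD: "t *\<^sub>R e_n \<in> D"
    proof -
      have "- e_n - t *\<^sub>R e_n = (- (1 + t)) *\<^sub>R (e_n :: 'a \<times> real)" by (simp add: algebra_simps)
      then show ?thesis using t g0 by (simp add: D_def dist_norm) (simp add: e_n_def)
    qed
    have "1 * u (t *\<^sub>R e_n) \<le> 1 * F ((norm (t *\<^sub>R e_n - - e_n :: 'a \<times> real))\<^sup>2)"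
    proof (rule radial_comparison[OF S(1,2) comp(1,2), where F = F and p = "- e_n" and T = "{1<..}" and ?F1.0 = F1 and ?F2.0 = F2])
      show "continuous_on D (\<lambda>x. F ((norm (x - - e_n))\<^sup>2))"
      proof -
        have "continuous_on {1..} s" unfolding s_def by (intro continuous_intros) auto
        then have "continuous_on {1..} F"
          unfolding F_def using s_nonneg \<phi>b
          by (intro continuous_intros continuous_on_powr') auto
        then show ?thesis
          by (rule continuous_on_compose2) (use D_ge in \<open>auto intro!: continuous_intros\<close>)
      qed
      show "(F has_real_derivative F1 a) (at a)" if "a \<in> {1<..}" for a
        unfolding F_def[abs_def] F1_def using that
        by (intro DERIV_cong[OF DERIV_add[OF DERIV_cmult[OF sp_der] DERIV_cmult[OF s_der]]])
           (auto simp: algebra_simps)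
      show "(F1 has_real_derivative F2 a) (at a)" if "a \<in> {1<..}" for a
      proof -
        have "1 < a" using that by simp
        note d = DERIV_mult[OF DERIV_add[OF DERIV_cmult[OF DERIV_cmult[OF sp_der[OF this]]] DERIV_const] s1_der[OF this]]
        show ?thesis unfolding F1_def[abs_def] F2_def
          by (rule DERIV_cong[OF d]) (simp add: algebra_simps)
      qed
      fix x assume xD: "x \<in> D" and "1 * F ((norm (x - - e_n))\<^sup>2) < 1 * u x"
      define \<alpha> where "\<alpha> = (norm (x - - e_n))\<^sup>2"
      have less: "F \<alpha> < u x" using \<open>1 * F _ < 1 * u x\<close> by (simp add: \<alpha>_def)
      have \<alpha>1: "1 \<le> \<alpha>" using D_ge[OF xD] by (simp add: \<alpha>_def)
      have ux: "0 < u x" using F_nonneg[OF \<alpha>1] less by simp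
      have xG: "x \<in> above_graph g"
        using tangent_solution_mem(1)[OF sol, of x] D_norm[OF xD] xD ux by (auto simp: D_def)
      have \<alpha>: "1 < \<alpha>"
        unfolding \<alpha>_def using xG by (intro exterior_ball(2)[OF sol]) (simp add: above_graph_def)
      have nx: "norm (x - - e_n) = dist (- e_n) x" by (simp add: dist_norm norm_minus_commute)
      have "dist (- e_n) x \<noteq> 2"
      proof
        assume "dist (- e_n) x = 2"
        then have "\<alpha> = 4" by (simp only: \<alpha>_def nx) simp
        have "(4::real) powr (- n) \<le> 4 powr (- 1)" using n by (intro powr_mono) auto
        also have "\<dots> = 1 / 4" by (simp add: powr_minus_divide)
        finally have "1 / 2 \<le> s 4" by (simp add: s_def)
        then have "B * (1 / 2) \<le> B * s 4" using B by (intro mult_left_mono) auto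
        then have "C3 * u e_n \<le> F \<alpha>" using A \<open>\<alpha> = 4\<close> by (simp add: F_def B_def add_increasing)
        moreover have "u x \<le> C3 * u e_n"
          using D_norm[OF xD] xD by (intro carleson[OF sol]) (auto simp: D_def)
        ultimately show False using less by simp
      qed
      moreover have "dist (- e_n) x \<le> 2" using xD by (simp add: D_def)
      ultimately have dx: "dist (- e_n) x < 2" by simp
      then have "x \<in> above_graph g \<inter> ball (- e_n) 2" using xG by simp
      moreover have "4 * \<alpha> * F2 \<alpha> + 2 * n * F1 \<alpha> < laplacian u x"
      proof -
        have \<alpha>4: "\<alpha> \<le> 4"
          unfolding \<alpha>_def nx using power_mono[of "dist (- e_n) x" 2 2] dx by simp
        have sp: "0 < s \<alpha>" by (rule s_pos[OF \<alpha>])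
        define q where "q = A * (\<phi> * s \<alpha> powr (\<phi> - 1)) + B"
        have q: "0 \<le> q" using A B \<phi>b by (simp add: q_def)
        have aa: "\<alpha> * \<alpha> powr (- n - 2) = \<alpha> powr (- n - 1)"
          using \<alpha> by (intro mult_powr_minus_two) simp
        have "4 * \<alpha> * s2 \<alpha> + 2 * n * s1 \<alpha> = - (2 * n * (n + 2)) * \<alpha> powr (- n - 1)"
          unfolding s1_def s2_def aa[symmetric] by (simp add: algebra_simps)
        also have "\<dots> \<le> 0" using n by (simp add: mult_nonneg_nonneg)
        finally have "q * (4 * \<alpha> * s2 \<alpha> + 2 * n * s1 \<alpha>) \<le> 0" using q by (simp add: mult_nonneg_nonpos)
        moreover have "4 * \<alpha> * F2 \<alpha> + 2 * n * F1 \<alpha> =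
           - (4 * \<phi> * (1 - \<phi>) * (\<alpha> * (s1 \<alpha>)\<^sup>2)) * (A * s \<alpha> powr (\<phi> - 2)) + q * (4 * \<alpha> * s2 \<alpha> + 2 * n * s1 \<alpha>)"
          unfolding F1_def F2_def q_def[symmetric] by (simp add: algebra_simps power2_eq_square)
        moreover have "c1 * (A * s \<alpha> powr (\<phi> - 2)) \<le> 4 * \<phi> * (1 - \<phi>) * (\<alpha> * (s1 \<alpha>)\<^sup>2) * (A * s \<alpha> powr (\<phi> - 2))"
        proof (rule mult_right_mono)
          have "\<alpha> * (s1 \<alpha>)\<^sup>2 = n\<^sup>2 * (\<alpha> powr 1 * \<alpha> powr (- n - 1) * \<alpha> powr (- n - 1))"
            using \<alpha> by (simp add: s1_def power2_eq_square)
          also have "\<dots> = n\<^sup>2 * \<alpha> powr (- 2 * n - 1)"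
            unfolding powr_add[symmetric] by simp
          finally have "n\<^sup>2 * 4 powr (- 2 * n - 1) \<le> \<alpha> * (s1 \<alpha>)\<^sup>2"
            using \<alpha> \<alpha>4 n by (auto intro!: mult_left_mono powr_mono2')
          then have "4 * \<phi> * (1 - \<phi>) * (n\<^sup>2 * 4 powr (- 2 * n - 1)) \<le> 4 * \<phi> * (1 - \<phi>) * (\<alpha> * (s1 \<alpha>)\<^sup>2)"
            using \<phi>b by (intro mult_left_mono) auto
          then show "c1 \<le> 4 * \<phi> * (1 - \<phi>) * (\<alpha> * (s1 \<alpha>)\<^sup>2)" by (simp add: c1_def mult.assoc)
        qed (use A in simp)
        ultimately have "4 * \<alpha> * F2 \<alpha> + 2 * n * F1 \<alpha> \<le> - (A * c1 * s \<alpha> powr (\<phi> - 2))"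
          by (simp add: mult_ac)
        also have "\<dots> = - ((A * s \<alpha> powr \<phi>) powr (- \<gamma>))"
          unfolding Ac using A sp scaling_exponent[OF \<gamma>0 \<phi>] by (simp add: powr_mult powr_powr)
        also have "\<dots> < - (u x powr (- \<gamma>))"
        proof -
          have "A * s \<alpha> powr \<phi> < u x" using less B sp by (simp add: F_def) (smt (verit) mult_pos_pos)
          then show ?thesis using \<gamma> A sp by (simp add: powr_less_mono2_neg)
        qed
        also have "\<dots> = laplacian u x" by (rule S(4)[OF xG, symmetric])
        finally show ?thesis .
      qed
      ultimately show "x \<in> above_graph g \<and> x \<in> interior D \<and> (norm (x - - e_n))\<^sup>2 \<in> {1<..} \<and>
         1 * (4 * (norm (x - - e_n))\<^sup>2 * F2 ((norm (x - - e_n))\<^sup>2) + 2 * DIM('a \<times> real) * F1 ((norm (x - - e_n))\<^sup>2))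
           < 1 * laplacian u x"
        using xG comp(3) \<alpha> unfolding \<alpha>_def[symmetric] n_def by auto
    qed (use teD in auto)
    moreover have "(norm (t *\<^sub>R e_n - - e_n :: 'a \<times> real))\<^sup>2 = (1 + t)\<^sup>2"
      by (simp add: norm_prod_power2 e_n_def add.commute)
    ultimately have uF: "u (t *\<^sub>R e_n) \<le> F ((1 + t)\<^sup>2)" by simp
    have st: "s ((1 + t)\<^sup>2) \<le> 2 * n * t" "0 \<le> s ((1 + t)\<^sup>2)"
    proof -
      have "((1 + t)\<^sup>2) powr (- n) = exp (- n * (2 * ln (1 + t)))"
        using t by (simp add: powr_def ln_realpow)
      moreover have "1 + (- n * (2 * ln (1 + t))) \<le> exp (- n * (2 * ln (1 + t)))"
        by (rule exp_ge_add_one_self)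
      moreover have "n * (2 * ln (1 + t)) \<le> n * (2 * t)"
        using n t ln_add_one_self_le_self[of t] by (intro mult_left_mono) auto
      ultimately show "s ((1 + t)\<^sup>2) \<le> 2 * n * t" by (simp add: s_def)
      show "0 \<le> s ((1 + t)\<^sup>2)" using t by (intro s_nonneg) (simp add: one_le_power)
    qed
    have "F ((1 + t)\<^sup>2) \<le> A * (2 * n * t) powr \<phi> + B * (2 * n * t)"
      unfolding F_def using A B st \<phi>b by (intro add_mono mult_left_mono powr_mono2) auto
    also have "\<dots> = A * (2 * n) powr \<phi> * t powr \<phi> + 4 * n * C3 * (u e_n * t)"
      using n t by (simp add: powr_mult B_def)
    also have "\<dots> \<le> C * t powr \<phi> + C * (u e_n * t)"
      using A C3 n e_n t by (intro add_mono mult_right_mono) (auto simp: C_def)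
    finally show "u (t *\<^sub>R e_n) \<le> C * (t powr \<phi> + u e_n * t)"
      using uF by (simp add: algebra_simps)
  qed
qed

text \<open>For \<open>t\<close> small the barrier is a multiple of \<open>|x - e\<^sub>n|\<^sup>-\<^sup>2\<^sup>n - (1 - t / 2)\<^sup>-\<^sup>2\<^sup>n\<close>. Stopping at radius
  \<open>1 - t / 2\<close>, instead of the tangent sphere, keeps the annulus away from the boundary.\<close>

lemma tangent_solution_lower_bound:
  fixes \<gamma> L :: real
  assumes \<gamma>: "\<gamma> > 0" and \<phi>: "\<phi> = 2 / (1 + \<gamma>)"
  obtains c :: real where "c > 0"
    "\<And>(g :: 'a::euclidean_space \<Rightarrow> real) u t. tangent_solution \<gamma> L g u \<Longrightarrow> 0 < t \<Longrightarrow> t \<le> 1 \<Longrightarrow>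
       c * t powr \<phi> \<le> u (t *\<^sub>R e_n) \<and> c * (u e_n * t) \<le> u (t *\<^sub>R e_n)"
proof -
  obtain H \<Lambda> :: real where H: "H \<ge> 1" and \<Lambda>: "\<Lambda> \<ge> 1" and
    harnack: "\<And>U u (x::'a \<times> real) y r. singular_solution \<gamma> U u \<Longrightarrow> r > 0 \<Longrightarrow> ball x (\<Lambda> * r) \<subseteq> U \<Longrightarrow>
       dist x y \<le> r \<Longrightarrow> u x \<le> H * u y"
    by (rule solution_harnack[OF \<gamma>, where 'a = "'a \<times> real"], rule that)
  define n where "n = real DIM('a \<times> real)"
  have n: "n \<ge> 1" by (simp add: n_def)
  define r where "r = 1 / (2 * \<Lambda>)"
  have r: "0 < r" "r < 1" "\<Lambda> * r = 1 / 2" using \<Lambda> by (auto simp: r_def)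
  define c1 where "c1 = r\<^sup>2 powr n / H"
  define c2 where "c2 = ball_const TYPE('a \<times> real) \<gamma> * (1 / 2) powr \<phi>"
  have r2: "0 < r\<^sup>2" "r\<^sup>2 \<le> 1" using r by (auto simp: power_le_one)
  have c: "0 < c1" "0 < c2" using r2 H ball_const_pos[where 'a = "'a \<times> real"] by (auto simp: c1_def c2_def)
  have c1H: "c1 \<le> 1 / H" unfolding c1_def using r2 n H by (intro divide_right_mono powr_le1) auto
  show ?thesis
  proof
    show "min c1 c2 > 0" using c by simp
    fix g :: "'a \<Rightarrow> real" and u and t :: real
    assume sol: "tangent_solution \<gamma> L g u" and t: "0 < t" "t \<le> 1"
    note S = singular_solutionD[OF tangent_solutionD(4)[OF sol]]
    have dist_t: "dist (e_n :: 'a \<times> real) (t *\<^sub>R e_n) = 1 - t"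
    proof -
      have "e_n - t *\<^sub>R e_n = (1 - t) *\<^sub>R (e_n :: 'a \<times> real)" by (simp add: algebra_simps)
      then show ?thesis using t by (simp add: dist_norm) (simp add: e_n_def)
    qed
    have sub: "cball e_n (1 - t / 2) \<subseteq> above_graph g"
      using t by (intro interior_ball[OF sol]) auto
    have pos: "0 < u x" if "dist e_n x \<le> 1 - t / 2" for x using that sub by (intro S(3)) auto
    have e_n: "0 < u e_n" using pos[of e_n] t by simp
    have "c2 * t powr \<phi> \<le> u (t *\<^sub>R e_n)"
    proof -
      have "cball (t *\<^sub>R e_n) (t / 2) \<subseteq> above_graph g"
      proof
        fix z :: "'a \<times> real" assume "z \<in> cball (t *\<^sub>R e_n) (t / 2)"
        then have "dist e_n z \<le> 1 - t / 2" using dist_triangle[of e_n z "t *\<^sub>R e_n"] dist_t by simp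
        then show "z \<in> above_graph g" using sub by auto
      qed
      then have "ball_const TYPE('a \<times> real) \<gamma> * (t / 2) powr \<phi> \<le> u (t *\<^sub>R e_n)"
        using t by (intro solution_ge_dist_powr[OF tangent_solutionD(4)[OF sol] \<gamma> \<phi>]) auto
      moreover have "(t / 2) powr \<phi> = (1 / 2) powr \<phi> * t powr \<phi>"
        using t powr_mult[of "1 / 2" t \<phi>] by simp
      ultimately show ?thesis by (simp add: c2_def mult.assoc)
    qed
    moreover have "c1 * (u e_n * t) \<le> u (t *\<^sub>R e_n)"
    proof -
      have near: "u e_n / H \<le> u x" if "dist e_n x \<le> r" for x
      proof -
        have "ball e_n (\<Lambda> * r) \<subseteq> above_graph g"
          using interior_ball[OF sol, of "1 / 2"] unfolding r(3) by force
        then have "u e_n \<le> H * u x" by (rule harnack[OF tangent_solutionD(4)[OF sol] r(1) _ that])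
        then show ?thesis using H by (simp add: field_simps)
      qed
      show ?thesis
      proof (cases "1 - t \<le> r")
        case True
        have "c1 * (u e_n * t) \<le> 1 / H * (u e_n * 1)"
          using c1H c t e_n H by (intro mult_mono) auto
        also have "\<dots> \<le> u (t *\<^sub>R e_n)" using near[of "t *\<^sub>R e_n"] dist_t True by simp
        finally show ?thesis .
      next
        case False
        define R where "R = 1 - t / 2"
        have R: "0 < R" "R < 1" "r < 1 - t" "1 - t < R" using False t r by (auto simp: R_def)
        define B where "B = c1 * u e_n"
        have B: "0 < B" using c e_n by (simp add: B_def)
        define F where "F a = B * (a powr (- n) - R\<^sup>2 powr (- n))" for a :: real
        define F1 where "F1 a = B * (- n * a powr (- n - 1))" for a :: real
        define F2 where "F2 a = B * (- n * ((- n - 1) * a powr (- n - 2)))" for a :: real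
        define D where "D = cball e_n R - (ball e_n r :: ('a \<times> real) set)"
        have nx: "norm (x - e_n) = dist e_n x" for x :: "'a \<times> real"
          by (simp add: dist_norm norm_minus_commute)
        have DU: "D \<subseteq> above_graph g" using sub by (auto simp: D_def R_def)
        have \<alpha>pos: "0 < (norm (x - e_n))\<^sup>2" if "x \<in> D" for x :: "'a \<times> real"
          using that r unfolding nx by (auto simp: D_def)
        have "- 1 * u (t *\<^sub>R e_n) \<le> - 1 * F ((norm (t *\<^sub>R e_n - e_n :: 'a \<times> real))\<^sup>2)"
        proof (rule radial_comparison[OF S(1,2), where D = D and F = F and p = e_n and \<sigma> = "- 1" and T = "{0<..}"
              and ?F1.0 = F1 and ?F2.0 = F2])
          show "compact D" unfolding D_def by (intro compact_diff compact_cball open_ball)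
          show "continuous_on D u"
            by (rule continuous_on_subset[OF C2_on_continuous(1)[OF S(2)] DU])
          show "continuous_on D (\<lambda>x. F ((norm (x - e_n))\<^sup>2))"
            unfolding F_def using \<alpha>pos by (intro continuous_intros) force+
          show "(F has_real_derivative F1 a) (at a)" if "a \<in> {0<..}" for a
          proof -
            have "((\<lambda>a. a powr (- n) - R\<^sup>2 powr (- n)) has_real_derivative - n * a powr (- n - 1) - 0) (at a)"
              using that by (intro DERIV_diff has_real_derivative_powr_minus DERIV_const) simp
            from DERIV_cmult[OF this] show ?thesis by (simp add: F_def[abs_def] F1_def)
          qed
          show "(F1 has_real_derivative F2 a) (at a)" if "a \<in> {0<..}" for a
            unfolding F1_def[abs_def] F2_def using that
            by (intro DERIV_cmult has_real_derivative_powr_minus_one) simp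
          fix x assume xD: "x \<in> D" and "- 1 * F ((norm (x - e_n))\<^sup>2) < - 1 * u x"
          define \<alpha> where "\<alpha> = (norm (x - e_n))\<^sup>2"
          have less: "u x < F \<alpha>" using \<open>- 1 * F _ < - 1 * u x\<close> by (simp add: \<alpha>_def)
          have \<alpha>: "0 < \<alpha>" using \<alpha>pos[OF xD] by (simp add: \<alpha>_def)
          have xG: "x \<in> above_graph g" using xD DU by blast
          have ux: "0 < u x" by (rule S(3)[OF xG])
          have "dist e_n x \<noteq> R"
          proof
            assume "dist e_n x = R"
            then have "F \<alpha> = 0" unfolding \<alpha>_def nx by (simp add: F_def)
            with less ux show False by simp
          qed
          moreover have "dist e_n x \<noteq> r"
          proof
            assume eq: "dist e_n x = r"
            have "F \<alpha> \<le> B * r\<^sup>2 powr (- n)"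
              unfolding \<alpha>_def nx eq F_def using B by (intro mult_left_mono) auto
            also have "\<dots> = u e_n / H" using r2 by (simp add: B_def c1_def powr_minus)
            also have "\<dots> \<le> u x" using eq by (intro near) simp
            finally show False using less by simp
          qed
          ultimately have "x \<in> ball e_n R - cball e_n r" using xD by (auto simp: D_def)
          moreover have "ball e_n R - cball e_n r \<subseteq> interior D"
            by (rule interior_maximal) (auto simp: D_def)
          moreover have "0 \<le> 4 * \<alpha> * F2 \<alpha> + 2 * n * F1 \<alpha>"
          proof -
            have eq: "\<alpha> powr (- n - 1) = \<alpha> * \<alpha> powr (- n - 2)"
              by (rule mult_powr_minus_two[OF \<alpha>, symmetric])
            have "4 * \<alpha> * F2 \<alpha> + 2 * n * F1 \<alpha> = B * (2 * n * (n + 2)) * (\<alpha> * \<alpha> powr (- n - 2))"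
              unfolding F1_def F2_def eq by (simp add: algebra_simps)
            also have "0 \<le> \<dots>" using B n \<alpha> by (intro mult_nonneg_nonneg) auto
            finally show ?thesis .
          qed
          moreover have "0 < - laplacian u x" using S(4)[OF xG] ux by simp
          ultimately show "x \<in> above_graph g \<and> x \<in> interior D \<and> (norm (x - e_n))\<^sup>2 \<in> {0<..} \<and>
             - 1 * (4 * (norm (x - e_n))\<^sup>2 * F2 ((norm (x - e_n))\<^sup>2) + 2 * DIM('a \<times> real) * F1 ((norm (x - e_n))\<^sup>2))
               < - 1 * laplacian u x"
            using xG \<alpha> unfolding \<alpha>_def[symmetric] n_def by auto
        next
          show "t *\<^sub>R e_n \<in> D" using dist_t R by (simp add: D_def)
        qed simp
        then have "F ((1 - t)\<^sup>2) \<le> u (t *\<^sub>R e_n)" by (simp add: nx dist_t)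
        moreover have "t \<le> ((1 - t)\<^sup>2) powr (- n) - R\<^sup>2 powr (- n)"
        proof -
          define q where "q = (R / (1 - t))\<^sup>2"
          have t1: "0 < 1 - t" using R r by linarith
          have "(1 + t / 2) * (1 - t) \<le> R" by (simp add: R_def algebra_simps)
          then have "1 + t / 2 \<le> R / (1 - t)" using t1 by (simp add: pos_le_divide_eq)
          then have "(1 + t / 2)\<^sup>2 \<le> q" unfolding q_def using t by (intro power_mono) auto
          moreover have "1 + t \<le> (1 + t / 2)\<^sup>2" by (simp add: power2_eq_square algebra_simps)
          ultimately have q: "1 + t \<le> q" by linarith
          have "q powr 1 \<le> q powr n" using q t n by (intro powr_mono) auto
          then have qn: "t \<le> q powr n - 1" using q t by simp
          have Rn: "1 \<le> R\<^sup>2 powr (- n)"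
            using R n powr_mono2'[of "- n" "R\<^sup>2" 1] by (simp add: power_le_one)
          have "((1 - t)\<^sup>2) powr (- n) = q powr n * R\<^sup>2 powr (- n)"
            using t1 R by (simp add: q_def power_divide powr_divide powr_minus inverse_eq_divide)
          then have "((1 - t)\<^sup>2) powr (- n) - R\<^sup>2 powr (- n) = R\<^sup>2 powr (- n) * (q powr n - 1)"
            by (simp add: algebra_simps)
          also have "1 * t \<le> \<dots>" using Rn qn t by (intro mult_mono) auto
          finally show ?thesis by simp
        qed
        then have "B * t \<le> F ((1 - t)\<^sup>2)" unfolding F_def using B by (intro mult_left_mono) auto
        ultimately show ?thesis by (simp add: B_def mult_ac)
      qed
    qed
    moreover have "min c1 c2 * t powr \<phi> \<le> c2 * t powr \<phi>" "min c1 c2 * (u e_n * t) \<le> c1 * (u e_n * t)"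
      using e_n t by (auto intro!: mult_right_mono)
    ultimately show "min c1 c2 * t powr \<phi> \<le> u (t *\<^sub>R e_n) \<and> min c1 c2 * (u e_n * t) \<le> u (t *\<^sub>R e_n)"
      by linarith
  qed
qed

lemma C01_norm_le_imp_lipschitz:
  assumes "C01_norm S g \<le> ennreal L" "L > 0" "x \<in> S" "y \<in> S"
  shows "\<bar>g x - g y\<bar> \<le> L * dist x y"
proof (cases "x = y")
  case False
  have "ennreal (\<bar>g x - g y\<bar> / dist x y) \<le> (SUP y\<in>S - {x}. ennreal (\<bar>g x - g y\<bar> / dist x y))"
    using False assms by (intro SUP_upper) auto
  also have "\<dots> \<le> (SUP x\<in>S. SUP y\<in>S - {x}. ennreal (\<bar>g x - g y\<bar> / dist x y))"
    using assms(3) by (rule SUP_upper)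
  also have "\<dots> \<le> C01_norm S g" by (simp add: C01_norm_def)
  also have "\<dots> \<le> ennreal L" by (rule assms)
  finally have "\<bar>g x - g y\<bar> / dist x y \<le> L" using assms(2) by simp
  then show ?thesis using False by (simp add: pos_divide_le_eq)
qed (use assms in simp)

lemma sphere_cap_bounds:
  fixes R r :: real
  assumes "1600 \<le> R" "0 \<le> r" "r < 20"
  shows "R - sqrt (R\<^sup>2 - r\<^sup>2) \<le> 1 / 4"
    and "r \<le> 1 \<Longrightarrow> R - sqrt (R\<^sup>2 - r\<^sup>2) \<le> 1 - sqrt (1 - r\<^sup>2)"
proof -
  have "r\<^sup>2 \<le> 20\<^sup>2" using assms by (intro power_mono) auto
  then have "(R - 1 / 4)\<^sup>2 \<le> R\<^sup>2 - r\<^sup>2"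
    using assms by (simp add: power2_eq_square algebra_simps)
  then show "R - sqrt (R\<^sup>2 - r\<^sup>2) \<le> 1 / 4" using real_le_rsqrt by fastforce
  show "R - sqrt (R\<^sup>2 - r\<^sup>2) \<le> 1 - sqrt (1 - r\<^sup>2)" if "r \<le> 1"
  proof -
    define w where "w = sqrt (1 - r\<^sup>2)"
    have r1: "r\<^sup>2 \<le> 1" using that assms by (simp add: power_le_one)
    have w: "w\<^sup>2 = 1 - r\<^sup>2" "w \<le> 1" using r1 by (auto simp: w_def)
    have "(R - 1) * w \<le> (R - 1) * 1" using w assms by (intro mult_left_mono) auto
    then have "(R - 1 + w)\<^sup>2 \<le> R\<^sup>2 - r\<^sup>2"
      using w(1) by (simp add: power2_eq_square algebra_simps)
    then have "R - 1 + w \<le> sqrt (R\<^sup>2 - r\<^sup>2)" by (rule real_le_rsqrt)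
    then show ?thesis by (simp add: w_def)
  qed
qed

lemma is_solution_imp_tangent_solution:
  fixes g :: "'a::euclidean_space \<Rightarrow> real"
  assumes L: "L > 0" and K: "0 < K" "K \<le> 1 / 1600"
    and lip: "C01_norm (ball 0 20) g \<le> ennreal L"
    and pinch: "\<And>x. x \<in> ball 0 20 \<Longrightarrow> - (1 / K) + sqrt (1 / K\<^sup>2 - (norm x)\<^sup>2) \<le> g x \<and>
      g x \<le> 1 / K - sqrt (1 / K\<^sup>2 - (norm x)\<^sup>2)"
    and sol: "is_solution \<gamma> g 20 u"
  shows "tangent_solution \<gamma> L g u"
proof -
  note lip' = C01_norm_le_imp_lipschitz[OF lip L]
  have R: "1600 \<le> 1 / K" using K by (simp add: field_simps)
  have abs_g: "\<bar>g x\<bar> \<le> 1 / K - sqrt ((1 / K)\<^sup>2 - (norm x)\<^sup>2)" if "norm x < 20" for x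
    using pinch[of x] that by (simp add: power_divide abs_le_iff)
  have cg: "continuous_on (ball 0 20) g"
    by (rule abs_diff_le_dist_imp_continuous_on) (rule lip')
  have sub: "above_graph g \<subseteq> grounded_cylinder g 20"
    by (auto simp: above_graph_def grounded_cylinder_def)
  have "open (above_graph g)"
  proof -
    have "continuous_on (ball 0 20 \<times> UNIV :: ('a \<times> real) set) (\<lambda>y. g (fst y))"
      by (rule continuous_on_compose2[OF cg continuous_on_fst[OF continuous_on_id]]) auto
    then have "continuous_on (ball 0 20 \<times> UNIV :: ('a \<times> real) set) (\<lambda>y. snd y - g (fst y))"
      by (intro continuous_on_diff continuous_on_snd continuous_on_id)
    then have "open ((ball 0 20 \<times> UNIV) \<inter> (\<lambda>y. snd y - g (fst y)) -` {0<..<20})"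
      by (intro continuous_open_preimage open_Times) auto
    moreover have "(ball 0 20 \<times> UNIV) \<inter> (\<lambda>y. snd y - g (fst y)) -` {0<..<20} = above_graph g"
      by (auto simp: above_graph_def)
    ultimately show ?thesis by simp
  qed
  then have int: "above_graph g \<subseteq> interior (grounded_cylinder g 20)"
    using sub by (simp add: interior_maximal)
  have "singular_solution \<gamma> (above_graph g) u"
    unfolding singular_solution_def
  proof (intro conjI ballI)
    show "open (above_graph g)" by fact
    show "C2_on (above_graph g) u"
      using sol int by (auto simp: is_solution_def intro: C2_on_subset)
    fix x assume x: "x \<in> above_graph g"
    then show "0 < u x" using sol sub by (auto simp: is_solution_def above_graph_def)
    show "- laplacian u x = u x powr - \<gamma>" using sol int x by (auto simp: is_solution_def)
  qed
  moreover have "continuous_on (above_graph g \<union> graph_over (ball 0 20) g) u"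
    using sol int by (auto simp: is_solution_def intro: continuous_on_subset)
  moreover have "\<bar>g x\<bar> \<le> 1 / 4" if "norm x < 20" for x
    using abs_g[OF that] sphere_cap_bounds(1)[OF R _ that] by simp
  moreover have "\<bar>g x\<bar> \<le> 1 - sqrt (1 - (norm x)\<^sup>2)" if "norm x \<le> 1" for x
    using abs_g[of x] sphere_cap_bounds(2)[OF R _ _ that] that by simp
  ultimately show ?thesis
    using lip' sol unfolding tangent_solution_def is_solution_def by auto
qed

lemma threshold_comparison:
  fixes \<gamma> lam t :: real
  assumes \<gamma>: "\<gamma> > 1" and \<phi>: "\<phi> = 2 / (1 + \<gamma>)" and pos: "lam > 0" "t > 0"
  shows "t \<le> lam powr ((1 + \<gamma>) / (1 - \<gamma>)) \<Longrightarrow> lam * t \<le> t powr \<phi>"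
    and "lam powr ((1 + \<gamma>) / (1 - \<gamma>)) \<le> t \<Longrightarrow> t powr \<phi> \<le> lam * t"
proof -
  define r where "r = (1 - \<gamma>) / (1 + \<gamma>)"
  have r: "r < 0" "\<phi> = r + 1" using \<gamma> by (auto simp: r_def \<phi> field_simps)
  have lam: "(lam powr ((1 + \<gamma>) / (1 - \<gamma>))) powr r = lam"
    using \<gamma> pos by (simp add: powr_powr r_def)
  have split: "t powr \<phi> = t powr r * t" using pos by (simp add: r powr_add)
  show "lam * t \<le> t powr \<phi>" if "t \<le> lam powr ((1 + \<gamma>) / (1 - \<gamma>))"
    unfolding split using powr_mono2'[OF _ pos(2) that, of r] r lam pos by (intro mult_right_mono) auto
  show "t powr \<phi> \<le> lam * t" if "lam powr ((1 + \<gamma>) / (1 - \<gamma>)) \<le> t"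
    unfolding split using powr_mono2'[OF _ _ that, of r] r lam pos by (intro mult_right_mono) auto
qed

theorem theorem3p1:
  fixes \<gamma> L \<phi> :: real
  assumes "\<gamma> > 1" and "L > 0" and "\<phi> = 2 / (1 + \<gamma>)"
  shows "\<exists>K0>0. \<forall>K. 0 < K \<and> K \<le> K0 \<longrightarrow>
    (\<exists>C>0. \<forall>(g :: real ^ 'm \<Rightarrow> real) (u :: (real ^ 'm) \<times> real \<Rightarrow> real) (lam :: real).
       C01_norm (ball 0 20) g \<le> ennreal L \<and>
       (\<forall>x\<in>ball 0 20. - (1 / K) + sqrt (1 / K\<^sup>2 - (norm x)\<^sup>2) \<le> g x \<and>
                      g x \<le> 1 / K - sqrt (1 / K\<^sup>2 - (norm x)\<^sup>2)) \<and>
       is_solution \<gamma> g 20 u \<and>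
       lam = u e_n \<longrightarrow>
         1 \<le> C * lam \<and>
         (\<forall>t\<in>{0..1}.
            (t \<le> lam powr ((1 + \<gamma>) / (1 - \<gamma>)) \<longrightarrow> comparable C (u (t *\<^sub>R e_n)) (t powr \<phi>)) \<and>
            (t \<ge> lam powr ((1 + \<gamma>) / (1 - \<gamma>)) \<longrightarrow> comparable C (u (t *\<^sub>R e_n)) (lam * t))))"
proof -
  have \<gamma>0: "\<gamma> > 0" using assms(1) by simp
  obtain C1 :: real where C1: "C1 > 0" and
    upper: "\<And>(g :: real ^ 'm \<Rightarrow> real) u t. tangent_solution \<gamma> L g u \<Longrightarrow> 0 < t \<Longrightarrow> t \<le> 1 \<Longrightarrow>
       u (t *\<^sub>R e_n) \<le> C1 * (t powr \<phi> + u e_n * t)"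
    by (rule tangent_solution_upper_bound[OF assms, where 'a = "real ^ 'm"], rule that)
  obtain c :: real where c: "c > 0" and
    lower: "\<And>(g :: real ^ 'm \<Rightarrow> real) u t. tangent_solution \<gamma> L g u \<Longrightarrow> 0 < t \<Longrightarrow> t \<le> 1 \<Longrightarrow>
       c * t powr \<phi> \<le> u (t *\<^sub>R e_n) \<and> c * (u e_n * t) \<le> u (t *\<^sub>R e_n)"
    by (rule tangent_solution_lower_bound[OF \<gamma>0 assms(3), where 'a = "real ^ 'm"], rule that)
  define C where "C = 2 * C1 + 1 / c"
  have C: "C > 0" "2 * C1 \<le> C" "1 / c \<le> C" using C1 c by (auto simp: C_def add_pos_pos)
  have main: "1 \<le> C * u e_n \<and>
      (\<forall>t\<in>{0..1}.
        (t \<le> u e_n powr ((1 + \<gamma>) / (1 - \<gamma>)) \<longrightarrow> comparable C (u (t *\<^sub>R e_n)) (t powr \<phi>)) \<and>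
        (t \<ge> u e_n powr ((1 + \<gamma>) / (1 - \<gamma>)) \<longrightarrow> comparable C (u (t *\<^sub>R e_n)) (u e_n * t)))"
    if sol: "tangent_solution \<gamma> L g u" for g :: "real ^ 'm \<Rightarrow> real" and u
  proof
    have cu: "c \<le> u e_n" using lower[OF sol, of 1] by simp
    then have pos: "0 < u e_n" using c by simp
    have le_C: "q \<le> C * p" if "c * q \<le> p" "0 \<le> p" for p q
    proof -
      have "q \<le> 1 / c * p" using that c by (simp add: field_simps)
      also have "\<dots> \<le> C * p" using that C by (intro mult_right_mono) auto
      finally show ?thesis .
    qed
    show "1 \<le> C * u e_n" using cu pos by (intro le_C) auto
    have comp: "comparable C p q" if "p \<le> C1 * (q + q')" "q' \<le> q" "c * q \<le> p" "0 \<le> q" for p q q'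
    proof -
      have "C1 * (q + q') \<le> C1 * (2 * q)" using that C1 by (intro mult_left_mono) auto
      also have "\<dots> \<le> C * q" using mult_right_mono[OF C(2) that(4)] by (simp add: mult_ac)
      finally have "p \<le> C * q" using that(1) by simp
      moreover have "0 \<le> p" using that c mult_nonneg_nonneg[of c q] by linarith
      ultimately show ?thesis using le_C[OF that(3)] by (simp add: comparable_def)
    qed
    show "\<forall>t\<in>{0..1}.
        (t \<le> u e_n powr ((1 + \<gamma>) / (1 - \<gamma>)) \<longrightarrow> comparable C (u (t *\<^sub>R e_n)) (t powr \<phi>)) \<and>
        (t \<ge> u e_n powr ((1 + \<gamma>) / (1 - \<gamma>)) \<longrightarrow> comparable C (u (t *\<^sub>R e_n)) (u e_n * t))"
    proof
      fix t :: real assume "t \<in> {0..1}"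
      then consider "t = 0" | "0 < t" "t \<le> 1" by fastforce
      then show "(t \<le> u e_n powr ((1 + \<gamma>) / (1 - \<gamma>)) \<longrightarrow> comparable C (u (t *\<^sub>R e_n)) (t powr \<phi>)) \<and>
        (t \<ge> u e_n powr ((1 + \<gamma>) / (1 - \<gamma>)) \<longrightarrow> comparable C (u (t *\<^sub>R e_n)) (u e_n * t))"
      proof cases
        case 1
        have "g 0 = 0" using tangent_solutionD(3)[OF sol, of 0] by simp
        then have "u 0 = 0" using tangent_solutionD(6)[OF sol, of 0] by (simp add: zero_prod_def)
        then show ?thesis using 1 by (simp add: comparable_def)
      next
        case 2
        note up = upper[OF sol 2] and low = lower[OF sol 2]
        note thr = threshold_comparison[OF assms(1,3) pos 2(1)]
        have "comparable C (u (t *\<^sub>R e_n)) (t powr \<phi>)" if "u e_n * t \<le> t powr \<phi>"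
          using up low that by (intro comp[where q' = "u e_n * t"]) auto
        moreover have "comparable C (u (t *\<^sub>R e_n)) (u e_n * t)" if "t powr \<phi> \<le> u e_n * t"
          using up low that pos 2 by (intro comp[where q' = "t powr \<phi>"]) (auto simp: add.commute)
        ultimately show ?thesis using thr by blast
      qed
    qed
  qed
  show ?thesis
  proof (rule exI[of _ "1 / 1600"], intro conjI allI impI)
    fix K :: real assume "0 < K \<and> K \<le> 1 / 1600"
    then have K: "0 < K" "K \<le> 1 / 1600" by auto
    show "\<exists>C>0. \<forall>(g :: real ^ 'm \<Rightarrow> real) (u :: (real ^ 'm) \<times> real \<Rightarrow> real) (lam :: real).
       C01_norm (ball 0 20) g \<le> ennreal L \<and>
       (\<forall>x\<in>ball 0 20. - (1 / K) + sqrt (1 / K\<^sup>2 - (norm x)\<^sup>2) \<le> g x \<and>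
                      g x \<le> 1 / K - sqrt (1 / K\<^sup>2 - (norm x)\<^sup>2)) \<and>
       is_solution \<gamma> g 20 u \<and>
       lam = u e_n \<longrightarrow>
         1 \<le> C * lam \<and>
         (\<forall>t\<in>{0..1}.
            (t \<le> lam powr ((1 + \<gamma>) / (1 - \<gamma>)) \<longrightarrow> comparable C (u (t *\<^sub>R e_n)) (t powr \<phi>)) \<and>
            (t \<ge> lam powr ((1 + \<gamma>) / (1 - \<gamma>)) \<longrightarrow> comparable C (u (t *\<^sub>R e_n)) (lam * t)))"
    proof (intro exI[of _ C] conjI[OF C(1)] allI impI)
      fix g :: "real ^ 'm \<Rightarrow> real" and u :: "(real ^ 'm) \<times> real \<Rightarrow> real" and lam :: real
      assume h: "C01_norm (ball 0 20) g \<le> ennreal L \<and>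
       (\<forall>x\<in>ball 0 20. - (1 / K) + sqrt (1 / K\<^sup>2 - (norm x)\<^sup>2) \<le> g x \<and>
                      g x \<le> 1 / K - sqrt (1 / K\<^sup>2 - (norm x)\<^sup>2)) \<and>
       is_solution \<gamma> g 20 u \<and> lam = u e_n"
      have "tangent_solution \<gamma> L g u"
        by (rule is_solution_imp_tangent_solution[OF assms(2) K]) (use h in auto)
      then show "1 \<le> C * lam \<and>
         (\<forall>t\<in>{0..1}.
            (t \<le> lam powr ((1 + \<gamma>) / (1 - \<gamma>)) \<longrightarrow> comparable C (u (t *\<^sub>R e_n)) (t powr \<phi>)) \<and>
            (t \<ge> lam powr ((1 + \<gamma>) / (1 - \<gamma>)) \<longrightarrow> comparable C (u (t *\<^sub>R e_n)) (lam * t)))"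
        using main h by blast
    qed
  qed simp
qed

end
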